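(* Suppose that the polynomials $p$ and $q$ satisfy the circular interlacing condition, have integer coefficients, and that $p$ is monic (and thus cyclotomic). Then: (a) if $p(1)=0$, or if $q(1)=0$ and $2p(1)-q'(1)<0$, then $(z^2-1)p(z)-zq(z)$ is the minimal polynomial of a Salem number (or perhaps of a reciprocal Pisot number), possibly multiplied by a cyclotomic polynomial. (Note that one of $p(1)$ and $q(1)$ is always $0$.) (b) always, $(z^2-z-1)p(z)-zq(z)$ is the minimal polynomial of a Pisot number.
   Context: A pair of relatively prime nonconstant polynomials $p$ and $q$ satisfies the circular interlacing condition if both have real coefficients and positive leading coefficient, and all their zeros lie on the unit circle and interlace there; the last condition means that, progressing clockwise around the unit circle, a zero of $p$ and a zero of $q$ are encountered alternately (so $p$ and $q$ have the same degree and neither has a multiple zero). A Salem number is a real algebraic integer greater than $1$ whose other conjugates over $\mathbb{Q}$ all lie in $|z|\leq 1$, with at least one on $|z|=1$. A Pisot number is a real algebraic integer greater than $1$ whose other conjugates all lie in $|z|<1$. A polynomial $P$ is reciprocal if $z^{\deg P}P(1/z)=P(z)$; a reciprocal Pisot number is a Pisot number whose minimal polynomial over $\mathbb{Q}$ is reciprocal (it is then necessarily quadratic). Here a "cyclotomic polynomial" means a monic integer polynomial all of whose zeros are roots of unity (not necessarily irreducible). *)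

theory Defs
  imports Complex_Main "HOL-Computational_Algebra.Computational_Algebra"
begin

text \<open>
  Going round clockwise is moving along decreasing angles.  The \<open>2 * n\<close> angles below are the
  successive points encountered in one turn, and the last inequality says that the turn ends
  before the first point is met again.  The zeros are compared as multisets, so a multiple zero
  of either polynomial violates the alternation.  Starting at a zero of \<open>p\<close> is no restriction, as
  the circle has no distinguished starting point.
\<close>

definition zeros_interlace_on_circle :: "complex poly \<Rightarrow> complex poly \<Rightarrow> bool" where
  "zeros_interlace_on_circle p q \<longleftrightarrow>
     (\<exists>(n::nat) (\<theta>::nat \<Rightarrow> real).
        (\<forall>i j. i < j \<and> j < 2 * n \<longrightarrow> \<theta> j < \<theta> i) \<and>
        \<theta> 0 - \<theta> (2 * n - 1) < 2 * pi \<and>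
        proots p = {#cis (\<theta> (2 * i)). i \<in># mset_set {..<n}#} \<and>
        proots q = {#cis (\<theta> (2 * i + 1)). i \<in># mset_set {..<n}#})"

definition circular_interlacing :: "real poly \<Rightarrow> real poly \<Rightarrow> bool" where
  "circular_interlacing p q \<longleftrightarrow>
     coprime p q \<and> degree p > 0 \<and> degree q > 0 \<and>
     lead_coeff p > 0 \<and> lead_coeff q > 0 \<and>
     (\<forall>z::complex. poly (map_poly of_real p) z = 0 \<longrightarrow> norm z = 1) \<and>
     (\<forall>z::complex. poly (map_poly of_real q) z = 0 \<longrightarrow> norm z = 1) \<and>
     zeros_interlace_on_circle (map_poly of_real p) (map_poly of_real q)"

definition is_minpoly :: "rat poly \<Rightarrow> complex \<Rightarrow> bool" where
  "is_minpoly m x \<longleftrightarrow> lead_coeff m = 1 \<and> irreducible m \<and> poly (map_poly of_rat m) x = 0"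

definition conjugates :: "complex \<Rightarrow> complex set" where
  "conjugates x = {z. \<exists>m. is_minpoly m x \<and> poly (map_poly of_rat m) z = 0}"

definition salem_number :: "real \<Rightarrow> bool" where
  "salem_number t \<longleftrightarrow>
     algebraic_int t \<and> t > 1 \<and>
     (\<forall>z \<in> conjugates (of_real t) - {of_real t}. norm z \<le> 1) \<and>
     (\<exists>z \<in> conjugates (of_real t) - {of_real t}. norm z = 1)"

definition pisot_number :: "real \<Rightarrow> bool" where
  "pisot_number t \<longleftrightarrow>
     algebraic_int t \<and> t > 1 \<and>
     (\<forall>z \<in> conjugates (of_real t) - {of_real t}. norm z < 1)"

text \<open>\<open>reflect_poly P\<close> is the polynomial \<open>z ^ degree P * P (1 / z)\<close>; see \<open>poly_reflect_poly_nz\<close>.\<close>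

definition reciprocal_poly :: "rat poly \<Rightarrow> bool" where
  "reciprocal_poly P \<longleftrightarrow> reflect_poly P = P"

definition reciprocal_pisot_number :: "real \<Rightarrow> bool" where
  "reciprocal_pisot_number t \<longleftrightarrow>
     pisot_number t \<and> (\<exists>m. is_minpoly m (of_real t) \<and> reciprocal_poly m)"

text \<open>Not necessarily irreducible; in particular the constant \<open>1\<close> counts as cyclotomic.\<close>

definition cyclotomic_poly :: "int poly \<Rightarrow> bool" where
  "cyclotomic_poly C \<longleftrightarrow>
     lead_coeff C = 1 \<and>
     (\<forall>z::complex. poly (map_poly of_int C) z = 0 \<longrightarrow> (\<exists>k>0. z ^ k = 1))"

end

theory Submission
  imports Defs "HOL-Computational_Algebra.Field_as_Ring"
begin

text \<open>
  Interlacing makes the quotient \<open>q / p\<close> a sum \<open>H z = (\<Sum>i<n. lam i * (z + \<alpha> i) / (z - \<alpha> i))\<close> with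
  positive weights over the zeros \<open>\<alpha> i\<close> of \<open>p\<close>, so \<open>H\<close> is a Caratheodory function on the exterior of
  the disc.  The zeros of \<open>(z\<^sup>2 - \<epsilon> z - 1) p - z q\<close> are the solutions of \<open>z - 1/z - \<epsilon> = H z\<close>, and
  positivity of the kernel \<open>(H z + cnj (H w)) / (z * cnj w - 1)\<close> leaves room for at most one solution
  outside the closed disc; it is simple, and it exists by the intermediate value theorem.  Taking
  real parts excludes solutions on the circle if \<open>\<epsilon> = 1\<close>, and for \<open>\<epsilon> = 0\<close> the equation is
  invariant under \<open>z \<mapsto> 1 / cnj z\<close>.  The constant coefficient is a unit, so the cofactor of the
  minimal polynomial of the outer zero has all its zeros on the circle, and Kronecker's theorem
  makes it cyclotomic.
\<close>

subsection \<open>Positive sums of Herglotz kernels on the circle\<close>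

locale positive_circle_sum =
  fixes n :: nat and \<alpha> :: "nat \<Rightarrow> complex" and lam :: "nat \<Rightarrow> real"
  assumes nonempty: "n > 0"
    and on_circle: "i < n \<Longrightarrow> norm (\<alpha> i) = 1"
    and weight_pos: "i < n \<Longrightarrow> lam i > 0"
begin

definition H :: "complex \<Rightarrow> complex" where
  "H z = (\<Sum>i<n. of_real (lam i) * ((z + \<alpha> i) / (z - \<alpha> i)))"

text \<open>A Gram kernel: \<open>S z w\<close> is the inner product, with weights
  \<open>lam i\<close>, of the vectors with entries \<open>1 / (z - \<alpha> i)\<close> and
  \<open>1 / (w - \<alpha> i)\<close>. It is therefore positive semidefinite.\<close>

definition S :: "complex \<Rightarrow> complex \<Rightarrow> complex" where
  "S z w = (\<Sum>i<n. of_real (lam i) / ((z - \<alpha> i) * cnj (w - \<alpha> i)))"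

lemma cnj_alpha: "i < n \<Longrightarrow> \<alpha> i * cnj (\<alpha> i) = 1"
  using on_circle[of i] by (simp flip: complex_norm_square)

text \<open>Over a common denominator, the numerator of the \<open>i\<close>-th term is
  \<open>2 * (z * cnj w - \<alpha> i * cnj (\<alpha> i))\<close>. Because \<open>\<alpha> i\<close>
  lies on the circle this does not depend on \<open>i\<close>, so it factors out of the sum.\<close>

lemma H_kernel:
  assumes "\<And>i. i < n \<Longrightarrow> z \<noteq> \<alpha> i" "\<And>i. i < n \<Longrightarrow> w \<noteq> \<alpha> i"
  shows "H z + cnj (H w) = 2 * (z * cnj w - 1) * S z w"
proof -
  have "of_real (lam i) * ((z + \<alpha> i) / (z - \<alpha> i)) + cnj (of_real (lam i) * ((w + \<alpha> i) / (w - \<alpha> i)))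
      = 2 * (z * cnj w - 1) * (of_real (lam i) / ((z - \<alpha> i) * cnj (w - \<alpha> i)))" if i: "i < n" for i
  proof -
    have nz: "z - \<alpha> i \<noteq> 0" "cnj w - cnj (\<alpha> i) \<noteq> 0"
      using assms[OF i] by (simp_all flip: complex_cnj_diff)
    have "(z + \<alpha> i) * (cnj w - cnj (\<alpha> i)) + (cnj w + cnj (\<alpha> i)) * (z - \<alpha> i)
        = 2 * (z * cnj w - \<alpha> i * cnj (\<alpha> i))"
      by (simp add: algebra_simps)
    then have eq: "(z + \<alpha> i) * (cnj w - cnj (\<alpha> i)) + (cnj w + cnj (\<alpha> i)) * (z - \<alpha> i)
        = 2 * (z * cnj w - 1)"
      by (simp only: cnj_alpha[OF i])
    have "(z + \<alpha> i) / (z - \<alpha> i) + (cnj w + cnj (\<alpha> i)) / (cnj w - cnj (\<alpha> i))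
        = 2 * (z * cnj w - 1) / ((z - \<alpha> i) * (cnj w - cnj (\<alpha> i)))"
      by (simp only: add_frac_eq[OF nz] eq)
    then have "of_real (lam i) * ((z + \<alpha> i) / (z - \<alpha> i) + (cnj w + cnj (\<alpha> i)) / (cnj w - cnj (\<alpha> i)))
        = of_real (lam i) * (2 * (z * cnj w - 1) / ((z - \<alpha> i) * (cnj w - cnj (\<alpha> i))))"
      by simp
    then show ?thesis by (simp add: distrib_left)
  qed
  then show ?thesis
    unfolding H_def S_def cnj_sum sum_distrib_left sum.distrib[symmetric]
    by (intro sum.cong) auto
qed

text \<open>The diagonal case \<open>w = z\<close> of \<open>H_kernel\<close>, whose factor
  \<open>z * cnj z - 1\<close> vanishes on the circle.\<close>

lemma Re_H_on_circle:
  assumes "norm z = 1" "\<And>i. i < n \<Longrightarrow> z \<noteq> \<alpha> i"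
  shows "Re (H z) = 0"
proof -
  have "z * cnj z = 1" using assms(1) by (simp flip: complex_norm_square)
  then have "H z + cnj (H z) = 0" using H_kernel[of z z] assms by simp
  then show ?thesis by (simp add: complex_eq_iff)
qed

text \<open>The factor in \<open>H_kernel\<close> also vanishes for the pair
  \<open>1 / cnj z\<close>, \<open>z\<close>; it remains to see that the reflected point is no
  pole.\<close>

lemma H_reflect:
  assumes "z \<noteq> 0" "\<And>i. i < n \<Longrightarrow> z \<noteq> \<alpha> i"
  shows "H (1 / cnj z) = - cnj (H z)"
proof -
  have "1 / cnj z \<noteq> \<alpha> i" if i: "i < n" for i
  proof
    assume "1 / cnj z = \<alpha> i"
    then have "\<alpha> i * cnj z = \<alpha> i * cnj (\<alpha> i)"
      using assms(1) cnj_alpha[OF i] by (auto simp: field_simps)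
    moreover have "\<alpha> i \<noteq> 0" using on_circle[OF i] by auto
    ultimately have "cnj z = cnj (\<alpha> i)" by simp
    then show False using assms(2)[OF i] by simp
  qed
  then have "H (1 / cnj z) + cnj (H z) = 0"
    using H_kernel[of "1 / cnj z" z] assms by simp
  then show ?thesis by (simp add: eq_neg_iff_add_eq_0)
qed

lemma outside: "norm z > 1 \<Longrightarrow> i < n \<Longrightarrow> z \<noteq> \<alpha> i"
  using on_circle[of i] by auto

text \<open>At a solution the kernel is \<open>S z w = (1/z + 1/cnj w) / 2 - \<epsilon> / (z * cnj w - 1)\<close>;
  the rank two part vanishes on the vector \<open>(1, -1)\<close>, on which the form \<open>S\<close> is positive.\<close>

lemma solution_unique:
  fixes \<epsilon> :: real
  assumes \<epsilon>: "\<epsilon> \<ge> 0" and z: "norm z > 1" and w: "norm w > 1"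
    and Hz: "z - 1 / z - of_real \<epsilon> = H z" and Hw: "w - 1 / w - of_real \<epsilon> = H w"
  shows "z = w"
proof -
  have S: "S u v = (1 / u + 1 / cnj v) / 2 - of_real \<epsilon> / (u * cnj v - 1)"
    if u: "u \<in> {z, w}" and v: "v \<in> {z, w}" for u v
  proof -
    have nu: "norm u > 1" "norm v > 1" using u v z w by auto
    then have "norm (u * cnj v) > 1"
      by (simp add: norm_mult less_1_mult)
    then have ne: "u * cnj v - 1 \<noteq> 0" by auto
    have nz: "u \<noteq> 0" "cnj v \<noteq> 0" using nu by auto
    have Hu: "u - 1 / u - of_real \<epsilon> = H u" and Hv: "v - 1 / v - of_real \<epsilon> = H v"
      using u v Hz Hw by auto
    have "u - 1 / u - of_real \<epsilon> + cnj (v - 1 / v - of_real \<epsilon>) = 2 * (u * cnj v - 1) * S u v"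
      unfolding Hu Hv by (intro H_kernel outside nu)
    then have "S u v = (u - 1 / u - of_real \<epsilon> + cnj (v - 1 / v - of_real \<epsilon>)) / (2 * (u * cnj v - 1))"
      using ne by simp
    also have "\<dots> = (1 / u + 1 / cnj v) / 2 - of_real \<epsilon> / (u * cnj v - 1)"
    proof -
      have "(u - 1 / u - of_real \<epsilon> + cnj (v - 1 / v - of_real \<epsilon>))
          = (u * cnj v - 1) * (1 / u + 1 / cnj v) - 2 * of_real \<epsilon>"
        using nz by (simp add: algebra_simps)
      then show ?thesis using ne by (simp only:) (simp add: field_simps)
    qed
    finally show ?thesis .
  qed
  \<comment> \<open>The form \<open>S\<close> on the vector \<open>(1, -1)\<close> is the weighted
    square norm of the difference \<open>d\<close> of the two vectors behind the Gram
    kernel.\<close>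
  define d where "d i = 1 / (z - \<alpha> i) - 1 / (w - \<alpha> i)" for i
  have "S z z + S w w - S z w - S w z = (\<Sum>i<n. of_real (lam i) * (d i * cnj (d i)))"
    unfolding S_def d_def sum.distrib[symmetric] sum_subtractf[symmetric]
    by (intro sum.cong refl, simp only: divide_inverse inverse_mult_distrib complex_cnj_diff
        complex_cnj_mult complex_cnj_inverse complex_cnj_one, simp add: algebra_simps)
  also have "\<dots> = of_real (\<Sum>i<n. lam i * (norm (d i))\<^sup>2)"
    by (simp only: of_real_sum of_real_mult complex_norm_square)
  finally have *: "S z z + S w w - S z w - S w z = of_real (\<Sum>i<n. lam i * (norm (d i))\<^sup>2)" .
  define a b c where "a = (norm z)\<^sup>2 - 1" and "b = (norm w)\<^sup>2 - 1" and "c = z * cnj w - 1"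
  have ab: "a > 0" "b > 0" using z w by (auto simp: a_def b_def one_less_power)
  \<comment> \<open>The part \<open>(1 / u + 1 / cnj v) / 2\<close> is a function of
    \<open>u\<close> plus a function of \<open>v\<close>, so it cancels in the alternating sum and
    only the \<epsilon> terms survive.\<close>
  have "S z z + S w w - S z w - S w z
      = - of_real \<epsilon> * (1 / of_real a + 1 / of_real b - (1 / c + 1 / cnj c))"
    by (simp add: S a_def b_def c_def complex_norm_square field_simps del: of_real_power)
  also have "1 / c + 1 / cnj c = of_real (2 * Re (1 / c))"
    using complex_add_cnj[of "1 / c"] by simp
  finally have "of_real (\<Sum>i<n. lam i * (norm (d i))\<^sup>2)
      = (of_real (- \<epsilon> * (1 / a + 1 / b - 2 * Re (1 / c))) :: complex)"
    using * by simp
  then have eq: "(\<Sum>i<n. lam i * (norm (d i))\<^sup>2) = - \<epsilon> * (1 / a + 1 / b - 2 * Re (1 / c))"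
    by (simp only: of_real_eq_iff)
  \<comment> \<open>Since \<open>|c|^2 - a * b = |z - w|^2\<close>, the modulus of \<open>c\<close>
    is at least the geometric mean of \<open>a\<close> and \<open>b\<close>; the inequality of
    arithmetic and geometric means for \<open>1 / a\<close> and \<open>1 / b\<close> does the
    rest.\<close>
  have "2 * Re (1 / c) \<le> 1 / a + 1 / b"
  proof -
    have "(norm c)\<^sup>2 - a * b = (norm (z - w))\<^sup>2"
      unfolding a_def b_def c_def cmod_power2 by (simp add: algebra_simps power2_eq_square)
    then have "a * b \<le> (norm c)\<^sup>2" by (smt (verit) zero_le_power2)
    then have cc: "norm c \<ge> sqrt (a * b)" by (simp add: real_le_lsqrt)
    have sq: "sqrt (a * b) > 0" using ab by simp
    have "Re (1 / c) \<le> 1 / norm c" using complex_Re_le_cmod[of "1 / c"] by (simp add: norm_divide)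
    also have "\<dots> \<le> 1 / sqrt (a * b)" using cc sq by (intro divide_left_mono mult_pos_pos) linarith+
    also have "\<dots> = sqrt (1 / a * (1 / b))" by (simp only: times_divide_times_eq mult_1 real_sqrt_divide real_sqrt_one)
    also have "\<dots> \<le> (1 / a + 1 / b) / 2" using ab by (intro arith_geo_mean_sqrt) auto
    finally show ?thesis by simp
  qed
  then have "(\<Sum>i<n. lam i * (norm (d i))\<^sup>2) \<le> 0"
    unfolding eq using \<epsilon> by (simp add: mult_nonneg_nonneg)
  moreover have "lam i * (norm (d i))\<^sup>2 \<ge> 0" if "i < n" for i
    using weight_pos[OF that] by simp
  \<comment> \<open>A sum of nonnegative terms that is at most 0 has only zero terms. A single index
    suffices, as \<open>1 / (z - \<alpha> 0)\<close> determines \<open>z\<close>.\<close>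
  ultimately have "lam 0 * (norm (d 0))\<^sup>2 = 0"
    using nonempty sum_nonneg_0[of "{..<n}" "\<lambda>i. lam i * (norm (d i))\<^sup>2" 0]
    by (smt (verit) finite_lessThan lessThan_iff sum_nonneg)
  then have "d 0 = 0" using weight_pos[OF nonempty] by auto
  then show ?thesis
    unfolding d_def by (simp add: divide_inverse)
qed

text \<open>The derivative of \<open>z - 1 / z\<close> at \<open>t\<close> is
  \<open>1 + 1 / t^2\<close>, while that of \<open>H\<close> has modulus at most
  \<open>2 * S t t\<close>, hence at most \<open>2 / t\<close>. The gap between the two bounds is
  \<open>(1 - 1 / t)^2 > 0\<close>.\<close>

lemma solution_simple:
  fixes \<epsilon> t :: real
  assumes \<epsilon>: "\<epsilon> \<ge> 0" and t: "t > 1"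
    and Ht: "of_real t - 1 / of_real t - of_real \<epsilon> = H (of_real t)"
  obtains D where "((\<lambda>z. z - 1 / z - of_real \<epsilon> - H z) has_field_derivative D) (at (of_real t))"
    and "D \<noteq> 0"
proof -
  let ?t = "of_real t :: complex"
  have out: "norm ?t > 1" using t by simp
  have nz: "?t - \<alpha> i \<noteq> 0" if "i < n" for i using outside[OF out that] by simp
  define D' where "D' = (\<Sum>i<n. of_real (lam i) * (- 2 * \<alpha> i / (?t - \<alpha> i)\<^sup>2))"
  have deriv: "((\<lambda>z. of_real (lam i) * ((z + \<alpha> i) / (z - \<alpha> i))) has_field_derivative
      of_real (lam i) * (- 2 * \<alpha> i / (?t - \<alpha> i)\<^sup>2)) (at ?t)" if "i < n" for i
    using nz[OF that] by (auto intro!: derivative_eq_intros simp: power2_eq_square) (auto simp: field_simps)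
  have dH: "(H has_field_derivative D') (at ?t)"
    unfolding H_def[abs_def] D'_def by (intro DERIV_sum) (use deriv in auto)
  have d: "((\<lambda>z. z - 1 / z - of_real \<epsilon> - H z) has_field_derivative (1 + 1 / ?t\<^sup>2 - D')) (at ?t)"
    using t dH by (auto intro!: derivative_eq_intros simp: power2_eq_square)
  have S: "S ?t ?t = of_real (\<Sum>i<n. lam i / (norm (?t - \<alpha> i))\<^sup>2)"
    unfolding S_def of_real_sum of_real_divide complex_norm_square ..
  have "norm D' \<le> (\<Sum>i<n. norm (of_real (lam i) * (- 2 * \<alpha> i / (?t - \<alpha> i)\<^sup>2)))"
    unfolding D'_def by (rule norm_sum)
  also have "\<dots> = (\<Sum>i<n. 2 * (lam i / (norm (?t - \<alpha> i))\<^sup>2))"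
    by (intro sum.cong) (use weight_pos on_circle in \<open>auto simp: norm_mult norm_divide norm_power less_imp_le\<close>)
  also have "\<dots> = 2 * Re (S ?t ?t)" unfolding S by (simp add: sum_distrib_left)
  finally have 1: "norm D' \<le> 2 * Re (S ?t ?t)" .
  \<comment> \<open>The diagonal of the kernel identity expresses \<open>S t t\<close> through
    \<open>Re (H t)\<close>, which the equation gives as \<open>t - 1 / t - \<epsilon>\<close>;
    dropping \<epsilon> yields \<open>S t t \<le> 1 / t\<close>.\<close>
  have "H ?t + cnj (H ?t) = 2 * (?t * cnj ?t - 1) * S ?t ?t"
    using H_kernel[of ?t ?t] nz by auto
  then have "Re (H ?t) = (t * t - 1) * Re (S ?t ?t)"
    unfolding S by (simp add: complex_eq_iff algebra_simps)
  moreover have "Re (H ?t) = t - 1 / t - \<epsilon>"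
    unfolding Ht[symmetric] by simp
  ultimately have "t - 1 / t - \<epsilon> = (t * t - 1) * Re (S ?t ?t)" by simp
  moreover have tt: "t * t - 1 > 0" using t by (simp add: less_1_mult)
  moreover have "t - 1 / t = (t * t - 1) * (1 / t)" using t by (simp add: field_simps)
  ultimately have "(t * t - 1) * Re (S ?t ?t) \<le> (t * t - 1) * (1 / t)" using \<epsilon> by simp
  then have "Re (S ?t ?t) \<le> 1 / t" by (rule mult_left_le_imp_le) (rule tt)
  moreover have "2 * (1 / t) < 1 + 1 / t\<^sup>2"
  proof -
    have "(1 - 1 / t)\<^sup>2 > 0" using t by simp
    then show ?thesis by (simp add: power2_diff power_divide)
  qed
  ultimately have "norm D' < 1 + 1 / t\<^sup>2" using 1 by simp
  moreover have "norm (1 + 1 / ?t\<^sup>2) = 1 + 1 / t\<^sup>2"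
  proof -
    have "1 + 1 / ?t\<^sup>2 = of_real (1 + 1 / t\<^sup>2)" by simp
    then show ?thesis by (simp only: norm_of_real) simp
  qed
  ultimately have "1 + 1 / ?t\<^sup>2 - D' \<noteq> 0" by auto
  with d that show ?thesis by blast
qed

end

subsection \<open>Partial fractions of an interlacing quotient\<close>

lemma cis_diff_eq: "cis x - cis y = 2 * \<i> * of_real (sin ((x - y) / 2)) * cis ((x + y) / 2)"
proof -
  have "cis x = cis ((x + y) / 2) * cis ((x - y) / 2)" "cis y = cis ((x + y) / 2) * cis (- ((x - y) / 2))"
    by (simp_all add: cis_mult field_simps)
  then have "cis x - cis y = cis ((x + y) / 2) * (cis ((x - y) / 2) - cis (- ((x - y) / 2)))"
    by (simp add: right_diff_distrib)
  also have "cis ((x - y) / 2) - cis (- ((x - y) / 2)) = 2 * \<i> * of_real (sin ((x - y) / 2))"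
    by (simp add: complex_eq_iff)
  finally show ?thesis by (simp add: mult_ac)
qed

text \<open>Trades a factor at a zero of \<open>q\<close> for the factor at the neighbouring zero of
  \<open>p\<close>. The cost is a real ratio and a phase that does not depend on \<open>x\<close>,
  so the phases can be collected over all factors.\<close>

lemma cis_diff_ratio:
  assumes "sin ((x - a) / 2) \<noteq> 0"
  shows "cis x - cis b = (cis x - cis a) * of_real (sin ((x - b) / 2) / sin ((x - a) / 2)) * cis ((b - a) / 2)"
proof -
  have "cis ((x + b) / 2) = cis ((x + a) / 2) * cis ((b - a) / 2)"
    by (simp add: cis_mult flip: add_divide_distrib)
  then show ?thesis using assms by (simp add: cis_diff_eq)
qed

lemma prod_cis: "finite A \<Longrightarrow> (\<Prod>i\<in>A. cis (f i)) = cis (\<Sum>i\<in>A. f i)"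
  by (induction A rule: finite_induct) (simp_all add: cis_mult)

lemma poly_eq_prod_proots:
  fixes p :: "complex poly"
  assumes "finite A" "proots p = {#f i. i \<in># mset_set A#}"
  shows "p = smult (lead_coeff p) (\<Prod>i\<in>A. [:- f i, 1:])"
  using complex_poly_decompose_multiset[of p] assms
  by (simp add: prod_unfold_prod_mset multiset.map_comp o_def)

text \<open>The summed gaps are disjoint pieces of the descent from the first to the last angle; the
  omitted gaps are positive.\<close>

lemma alternate_sum_le:
  fixes \<theta> :: "nat \<Rightarrow> real"
  assumes dec: "\<And>i j. i < j \<Longrightarrow> j < 2 * n \<Longrightarrow> \<theta> j < \<theta> i" and "0 < m" "m \<le> n"
  shows "(\<Sum>i<m. \<theta> (2 * i) - \<theta> (2 * i + 1)) \<le> \<theta> 0 - \<theta> (2 * m - 1)"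
  using assms(2,3)
proof (induction m)
  case (Suc m)
  show ?case
  proof (cases "m = 0")
    case False
    with Suc have "\<theta> (2 * m) < \<theta> (2 * m - 1)" by (intro dec) auto
    with Suc False show ?thesis by simp
  qed simp
qed simp

text \<open>Both half angles have the same sign and modulus below \<open>pi\<close>, so their sines
  share a sign.\<close>

lemma sin_half_ratio_pos:
  fixes x a b :: real
  assumes "x < a \<and> x < b \<or> a < x \<and> b < x" "\<bar>x - a\<bar> < 2 * pi" "\<bar>x - b\<bar> < 2 * pi"
  shows "sin ((x - b) / 2) / sin ((x - a) / 2) > 0"
  using assms(1)
proof
  assume *: "x < a \<and> x < b"
  have "sin ((a - x) / 2) > 0" "sin ((b - x) / 2) > 0"
    using * assms by (auto intro!: sin_gt_zero)
  moreover have "sin ((x - u) / 2) = - sin ((u - x) / 2)" for u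
    using sin_minus[of "(u - x) / 2"] by (simp add: minus_divide_left)
  ultimately show ?thesis by simp
next
  assume *: "a < x \<and> b < x"
  then show ?thesis using assms by (auto intro!: divide_pos_pos sin_gt_zero)
qed

text \<open>Up to a positive factor the residue of \<open>Q / P\<close> at \<open>\<alpha> j\<close> is \<open>\<i> * \<alpha> j * cis (- D / 2)\<close>, where \<open>D\<close> is
  the sum of the angle differences; the product of the zeros being real forces \<open>D = pi\<close>.\<close>

lemma interlacing_partial_fractions:
  fixes p q :: "real poly"
  defines "P \<equiv> map_poly complex_of_real p" and "Q \<equiv> map_poly complex_of_real q"
  assumes ci: "circular_interlacing p q"
  obtains n \<alpha> lam where "positive_circle_sum n \<alpha> lam"
    and "\<And>z. poly P z = 0 \<longleftrightarrow> (\<exists>i<n. z = \<alpha> i)"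
    and "\<And>z. poly P z \<noteq> 0 \<Longrightarrow> poly Q z = poly P z * positive_circle_sum.H n \<alpha> lam z"
proof -
  define lp lq where "lp = lead_coeff p" and "lq = lead_coeff q"
  have lp: "lp > 0" and lq: "lq > 0" and degp: "degree p > 0"
    using ci by (auto simp: circular_interlacing_def lp_def lq_def)
  have "zeros_interlace_on_circle P Q"
    using ci by (simp add: circular_interlacing_def P_def Q_def)
  then obtain n :: nat and \<theta> :: "nat \<Rightarrow> real" where dec': "\<forall>i j. i < j \<and> j < 2 * n \<longrightarrow> \<theta> j < \<theta> i"
    and turn: "\<theta> 0 - \<theta> (2 * n - 1) < 2 * pi"
    and rp: "proots P = {#cis (\<theta> (2 * i)). i \<in># mset_set {..<n}#}"
    and rq: "proots Q = {#cis (\<theta> (2 * i + 1)). i \<in># mset_set {..<n}#}"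
    unfolding zeros_interlace_on_circle_def by (elim exE conjE)
  have dec: "\<theta> j < \<theta> i" if "i < j" "j < 2 * n" for i j
    using dec' that by simp
  define a b where "a i = \<theta> (2 * i)" and "b i = \<theta> (2 * i + 1)" for i :: nat
  define \<alpha> \<beta> where "\<alpha> i = cis (a i)" and "\<beta> i = cis (b i)" for i :: nat
  have lead: "lead_coeff P = of_real lp" "lead_coeff Q = of_real lq"
    by (simp_all add: P_def Q_def lp_def lq_def degree_map_poly coeff_map_poly)
  have P: "P = smult (of_real lp) (\<Prod>i<n. [:- \<alpha> i, 1:])"
    and Q: "Q = smult (of_real lq) (\<Prod>i<n. [:- \<beta> i, 1:])"
    using poly_eq_prod_proots[OF _ rp] poly_eq_prod_proots[OF _ rq]
    by (simp_all add: lead \<alpha>_def \<beta>_def a_def b_def)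
  have pP: "poly P z = of_real lp * (\<Prod>i<n. z - \<alpha> i)"
    and pQ: "poly Q z = of_real lq * (\<Prod>i<n. z - \<beta> i)" for z
    by (subst P, simp add: poly_prod) (subst Q, simp add: poly_prod)
  have n: "n > 0"
  proof (rule ccontr)
    assume "\<not> n > 0"
    then have "P = [:of_real lp:]" using P by simp
    then have "degree P = 0" by simp
    then show False using degp by (simp add: P_def degree_map_poly)
  qed
  have le0: "\<theta> k \<le> \<theta> 0" and gel: "\<theta> (2 * n - 1) \<le> \<theta> k" if "k < 2 * n" for k
    using dec[of 0 k] dec[of k "2 * n - 1"] that by (cases "k = 0"; cases "k = 2 * n - 1"; fastforce)+
  have dist: "\<bar>\<theta> k - \<theta> l\<bar> < 2 * pi" if "k < 2 * n" "l < 2 * n" for k l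
    using le0[OF that(1)] le0[OF that(2)] gel[OF that(1)] gel[OF that(2)] turn by linarith
  define D where "D = (\<Sum>i<n. a i - b i)"
  have "a i - b i > 0" if "i < n" for i
    using dec[of "2 * i" "2 * i + 1"] that by (simp add: a_def b_def)
  then have "D > 0" unfolding D_def using n by (intro sum_pos) auto
  moreover have "D < 2 * pi"
    using alternate_sum_le[where \<theta> = \<theta>, OF _ n order.refl] dec turn by (simp add: D_def a_def b_def)
  moreover have prodb: "(\<Prod>i<n. \<beta> i) = (\<Prod>i<n. \<alpha> i) * cis (- D)"
    by (simp add: \<alpha>_def \<beta>_def prod_cis cis_mult D_def sum_subtractf)
  have P0: "poly P 0 = of_real (lp * (-1) ^ n) * (\<Prod>i<n. \<alpha> i)"
    and Q0: "poly Q 0 = of_real (lq * (-1) ^ n) * (\<Prod>i<n. \<beta> i)"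
    by (simp_all add: pP pQ prod_uminus)
  have P0r: "poly P 0 = of_real (poly p 0)" "poly Q 0 = of_real (poly q 0)"
    by (simp_all add: P_def Q_def poly_0_coeff_0 coeff_map_poly)
  \<comment> \<open>Up to real factors the products of the zeros are the constant coefficients of
    real polynomials, so both are real. Their quotient \<open>cis (- D)\<close> is then real, and
    \<open>pi\<close> is the only zero of the sine strictly between 0 and
    \<open>2 * pi\<close>.\<close>
  have "(\<Prod>i<n. \<alpha> i) = of_real (poly p 0 / (lp * (-1) ^ n))"
    using P0 P0r lp by (simp add: field_simps)
  moreover have "(\<Prod>i<n. \<beta> i) = of_real (poly q 0 / (lq * (-1) ^ n))"
    using Q0 P0r lq by (simp add: field_simps)
  moreover have prodnz: "(\<Prod>i<n. \<alpha> i) \<noteq> 0" by (simp add: \<alpha>_def)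
  ultimately have "sin D = 0"
    using prodb
    by (auto simp: complex_eq_iff simp del: of_real_divide of_real_mult)
  then have D: "D = pi"
    using \<open>D > 0\<close> \<open>D < 2 * pi\<close> sin_gt_zero[of D] sin_lt_zero[of D] by fastforce
  \<comment> \<open>The quotient \<open>Q / P\<close> thus takes opposite values at 0 and at
    infinity; this will remove the constant term of the partial fraction expansion.\<close>
  have PQ0: "poly Q 0 = - of_real (lq / lp) * poly P 0"
    using lp by (simp add: P0 Q0 prodb D flip: cis_cnj)
  define r where "r i j = sin ((a j - b i) / 2) / sin ((a j - a i) / 2)" for i j
  \<comment> \<open>The consecutive zeros with angles \<open>a i\<close> and \<open>b i\<close> lie
    on the same side of \<open>a j\<close>, since nothing separates them in the ordering.\<close>
  have sep: "a j < a i \<and> a j < b i \<or> a i < a j \<and> b i < a j" if "i < n" "j < n" "i \<noteq> j" for i j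
    using that dec[of "2 * j" "2 * i"] dec[of "2 * i" "2 * j"] dec[of "2 * j" "2 * i + 1"]
      dec[of "2 * i + 1" "2 * j"]
    by (cases "i < j") (auto simp: a_def b_def)
  have r: "r i j > 0" if "i < n" "j < n" "i \<noteq> j" for i j
    unfolding r_def using sep[OF that] dist[of "2 * j" "2 * i"] dist[of "2 * j" "2 * i + 1"] that
    by (intro sin_half_ratio_pos) (auto simp: a_def b_def)
  \<comment> \<open>Chosen so that \<open>2 * lam j * \<alpha> j\<close> is the residue of
    \<open>Q / P\<close> at \<open>\<alpha> j\<close>. The sine comes from the chord between
    \<open>\<alpha> j\<close> and \<open>\<beta> j\<close>, the factors \<open>r i j\<close> from
    all other pairs.\<close>
  define lam where "lam j = lq / lp * sin ((a j - b j) / 2) * (\<Prod>i\<in>{..<n} - {j}. r i j)" for j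
  have lam: "lam j > 0" if "j < n" for j
  proof -
    have "sin ((a j - b j) / 2) > 0"
      using dist[of "2 * j" "2 * j + 1"] dec[of "2 * j" "2 * j + 1"] that
      by (intro sin_gt_zero) (auto simp: a_def b_def)
    moreover have "(\<Prod>i\<in>{..<n} - {j}. r i j) > 0" using r that by (intro prod_pos) auto
    ultimately show ?thesis using lp lq by (simp add: lam_def)
  qed
  interpret positive_circle_sum n \<alpha> lam
    using n lam by unfold_locales (auto simp: \<alpha>_def)
  define PJ where "PJ j = smult (of_real lp) (\<Prod>i\<in>{..<n} - {j}. [:- \<alpha> i, 1:])" for j
  have PJ: "P = [:- \<alpha> j, 1:] * PJ j" if "j < n" for j
    unfolding PJ_def by (subst P, subst prod.remove[of _ j]) (use that in auto)
  have pPJ: "poly P z = (z - \<alpha> j) * poly (PJ j) z" if "j < n" for j z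
    by (subst PJ[OF that]) (simp add: left_diff_distrib)
  have sinne: "sin ((a j - a i) / 2) \<noteq> 0" if "i < n" "j < n" "i \<noteq> j" for i j
    using r[OF that] by (auto simp: r_def)
  have Q_root: "poly Q (\<alpha> j) = of_real (lam j) * (2 * \<alpha> j) * poly (PJ j) (\<alpha> j)" if j: "j < n" for j
  proof -
    let ?J = "{..<n} - {j}"
    have "(\<Prod>i\<in>?J. \<alpha> j - \<beta> i) = (\<Prod>i\<in>?J. (\<alpha> j - \<alpha> i) * of_real (r i j) * cis ((b i - a i) / 2))"
      unfolding \<alpha>_def \<beta>_def r_def using sinne j by (intro prod.cong cis_diff_ratio) auto
    also have "\<dots> = (\<Prod>i\<in>?J. \<alpha> j - \<alpha> i) * of_real (\<Prod>i\<in>?J. r i j) * cis (\<Sum>i\<in>?J. (b i - a i) / 2)"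
      by (simp add: prod.distrib prod_cis)
    finally have 1: "(\<Prod>i\<in>?J. \<alpha> j - \<beta> i) = \<dots>" .
    have 2: "\<alpha> j - \<beta> j = 2 * \<i> * of_real (sin ((a j - b j) / 2)) * \<alpha> j * cis ((b j - a j) / 2)"
      unfolding \<alpha>_def \<beta>_def cis_diff_eq by (simp add: mult.assoc cis_mult field_simps)
    \<comment> \<open>All phases together give \<open>cis (- D / 2)\<close>, that is
      \<open>- \<i>\<close>, which cancels the \<open>\<i>\<close> of the chord formula and leaves a
      real weight.\<close>
    have "(\<Sum>i\<in>?J. (b i - a i) / 2) + (b j - a j) / 2 = (\<Sum>i<n. (b i - a i) / 2)"
      using j by (subst (2) sum.remove[of _ j]) auto
    also have "\<dots> = - (D / 2)" unfolding D_def sum_divide_distrib sum_negf[symmetric]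
      by (intro sum.cong) (auto simp: field_simps)
    finally have 3: "cis (\<Sum>i\<in>?J. (b i - a i) / 2) * cis ((b j - a j) / 2) = - \<i>"
      using D by (simp add: cis_mult complex_eq_iff)
    have "poly Q (\<alpha> j) = of_real lq * ((\<alpha> j - \<beta> j) * (\<Prod>i\<in>?J. \<alpha> j - \<beta> i))"
      unfolding pQ using j by (subst prod.remove[of _ j]) auto
    also have "\<dots> = of_real lq * 2 * \<i> * of_real (sin ((a j - b j) / 2)) * \<alpha> j * (\<Prod>i\<in>?J. \<alpha> j - \<alpha> i)
        * of_real (\<Prod>i\<in>?J. r i j) * (cis (\<Sum>i\<in>?J. (b i - a i) / 2) * cis ((b j - a j) / 2))"
      unfolding 1 2 by (simp only: mult_ac)
    also have "\<dots> = of_real (lam j) * (2 * \<alpha> j) * (of_real lp * (\<Prod>i\<in>?J. \<alpha> j - \<alpha> i))"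
      unfolding 3 using lp by (simp add: lam_def)
    finally show ?thesis by (simp add: PJ_def poly_prod)
  qed
  \<comment> \<open>\<open>R\<close> is the numerator of \<open>Q / P - H\<close>, and
    \<open>k\<close> is the value of that difference at infinity.\<close>
  define k where "k = lq / lp - (\<Sum>j<n. lam j)"
  define R where "R = Q - (\<Sum>j<n. smult (of_real (lam j)) ([:\<alpha> j, 1:] * PJ j))"
  have dP: "degree P = n" and cP: "coeff P n = of_real lp"
  proof -
    show "degree P = n" using lp by (subst P) (simp add: degree_prod_sum_eq)
    then show "coeff P n = of_real lp" using lead by simp
  qed
  have dQ: "degree Q = n" and cQ: "coeff Q n = of_real lq"
  proof -
    show "degree Q = n" using lq by (subst Q) (simp add: degree_prod_sum_eq)
    then show "coeff Q n = of_real lq" using lead by simp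
  qed
  have dPJ: "degree ([:\<alpha> j, 1:] * PJ j) = n" and cPJ: "coeff ([:\<alpha> j, 1:] * PJ j) n = of_real lp"
    if j: "j < n" for j
  proof -
    have eq: "[:\<alpha> j, 1:] * PJ j = P + smult (2 * \<alpha> j) (PJ j)"
    proof -
      have "[:\<alpha> j, 1:] = [:- \<alpha> j, 1:] + [:2 * \<alpha> j:]" by simp
      then have "[:\<alpha> j, 1:] * PJ j = [:- \<alpha> j, 1:] * PJ j + [:2 * \<alpha> j:] * PJ j"
        by (simp only: distrib_right)
      then show ?thesis using PJ[OF j] by simp
    qed
    have "n = degree ([:- \<alpha> j, 1:] * PJ j)" using PJ[OF j] dP by simp
    also have "\<dots> = Suc (degree (PJ j))" using dP n PJ[OF j] by (subst degree_mult_eq) auto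
    finally have d: "degree (PJ j) < n" by simp
    then have "degree (smult (2 * \<alpha> j) (PJ j)) < degree P"
      using degree_smult_le[of "2 * \<alpha> j" "PJ j"] dP by linarith
    then show "degree ([:\<alpha> j, 1:] * PJ j) = n" unfolding eq by (simp add: degree_add_eq_left dP)
    show "coeff ([:\<alpha> j, 1:] * PJ j) n = of_real lp" unfolding eq
      using d by (simp add: cP coeff_eq_0)
  qed
  have dR: "degree R \<le> n"
    unfolding R_def using dQ dPJ
    by (intro degree_diff_le degree_sum_le) (auto intro: order.trans[OF degree_smult_le])
  have cR: "coeff R n = of_real (k * lp)"
    using cPJ cQ lp by (simp add: R_def coeff_sum k_def field_simps sum_distrib_left del: mult_pCons_left)
  have pR: "poly R z = poly Q z - (\<Sum>j<n. of_real (lam j) * ((z + \<alpha> j) * poly (PJ j) z))" for z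
    by (simp add: R_def poly_sum algebra_simps)
  have Rroot: "poly R (\<alpha> j) = 0" if j: "j < n" for j
  proof -
    have "poly (PJ i) (\<alpha> j) = 0" if "i < n" "i \<noteq> j" for i
      using j that by (auto simp: PJ_def poly_prod intro!: bexI[of _ j])
    then have "(\<Sum>i<n. of_real (lam i) * ((\<alpha> j + \<alpha> i) * poly (PJ i) (\<alpha> j)))
        = of_real (lam j) * ((\<alpha> j + \<alpha> j) * poly (PJ j) (\<alpha> j))"
      using j by (subst sum.remove[of _ j]) auto
    then show ?thesis unfolding pR Q_root[OF j] by simp
  qed
  have inj: "inj_on \<alpha> {..<n}"
  proof (intro inj_onI, rule ccontr)
    fix i j assume *: "i \<in> {..<n}" "j \<in> {..<n}" "\<alpha> i = \<alpha> j" "i \<noteq> j"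
    then show False using sinne[of i j] cis_diff_eq[of "a j" "a i"] by (auto simp: \<alpha>_def)
  qed
  \<comment> \<open>Both sides vanish at the \<open>n\<close> distinct points
    \<open>\<alpha> j\<close> and agree in the coefficient of degree \<open>n\<close>.\<close>
  have Rk: "R = smult (of_real k) P"
  proof (rule poly_eqI_degree_lead_coeff[where A = "\<alpha> ` {..<n}" and n = n])
    show "card (\<alpha> ` {..<n}) \<ge> n" using inj by (simp add: card_image)
    show "degree (smult (of_real k) P) \<le> n" using dP by (simp add: degree_smult_le)
    show "coeff R n = coeff (smult (of_real k) P) n" by (simp add: cR cP)
  qed (use Rroot dR pP in auto)
  \<comment> \<open>Every kernel \<open>(z + \<alpha> j) / (z - \<alpha> j)\<close> equals -1 at 0.
    With \<open>PQ0\<close> this makes the value at 0 \<open>- k * P 0\<close>, against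
    \<open>k * P 0\<close> from \<open>Rk\<close>, so \<open>k = 0\<close>.\<close>
  have "poly R 0 = poly Q 0 + of_real (\<Sum>j<n. lam j) * poly P 0"
    unfolding pR using pPJ[of _ 0]
    by (simp add: sum_distrib_right sum_negf[symmetric] del: sum_negf)
  then have "of_real k * poly P 0 = - of_real k * poly P 0"
    unfolding Rk PQ0 by (simp add: k_def algebra_simps)
  moreover have "poly P 0 \<noteq> 0" using P0 prodnz lp by simp
  ultimately have "k = 0" by auto
  then have R0: "R = 0" using Rk by simp
  show ?thesis
  proof (rule that)
    show "positive_circle_sum n \<alpha> lam" by unfold_locales
    show rootP: "poly P z = 0 \<longleftrightarrow> (\<exists>i<n. z = \<alpha> i)" for z
      using lp by (auto simp: pP)
    show "poly Q z = poly P z * H z" if "poly P z \<noteq> 0" for z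
    proof -
      have nz: "z - \<alpha> j \<noteq> 0" if "j < n" for j using that \<open>poly P z \<noteq> 0\<close> rootP by auto
      have "poly Q z = (\<Sum>j<n. of_real (lam j) * ((z + \<alpha> j) * poly (PJ j) z))"
        using pR[of z] R0 by simp
      also have "\<dots> = (\<Sum>j<n. poly P z * (of_real (lam j) * ((z + \<alpha> j) / (z - \<alpha> j))))"
        using nz by (intro sum.cong refl) (simp add: pPJ[of _ z])
      finally show ?thesis by (simp add: H_def sum_distrib_left)
    qed
  qed
qed

subsection \<open>Minimal polynomials and Kronecker's theorem\<close>

lemma map_poly_add_hom:
  assumes "f 0 = 0" "\<And>x y. f (x + y) = f x + f y"
  shows "map_poly f (p + q) = map_poly f p + map_poly f q"
  using assms by (intro poly_eqI) (simp add: coeff_map_poly)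

lemma map_poly_mult_hom:
  assumes f: "f 0 = 0" "\<And>x y. f (x + y) = f x + f y" "\<And>x y. f (x * y) = f x * f y"
  shows "map_poly f (p * q) = map_poly f p * map_poly f q"
proof (rule poly_eqI)
  fix k
  have "f (\<Sum>i\<le>k. coeff p i * coeff q (k - i)) = (\<Sum>i\<le>k. f (coeff p i * coeff q (k - i)))"
    using sum_comp_morphism[of f "\<lambda>i. coeff p i * coeff q (k - i)" "{..k}"] f by (simp add: o_def)
  then show "coeff (map_poly f (p * q)) k = coeff (map_poly f p * map_poly f q) k"
    by (simp add: coeff_map_poly coeff_mult f)
qed

lemma poly_map_poly_hom:
  assumes f: "f 0 = 0" "\<And>x y. f (x + y) = f x + f y" "\<And>x y. f (x * y) = f x * f y"
  shows "poly (map_poly f p) (f x) = f (poly p x)"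
  by (induction p) (simp_all add: f map_poly_pCons)

lemma map_poly_of_int_add:
  "map_poly of_int (p + q) = (map_poly of_int p + map_poly of_int q :: 'a :: comm_ring_1 poly)"
  by (rule map_poly_add_hom) simp_all

lemma map_poly_of_int_mult:
  "map_poly of_int (p * q) = (map_poly of_int p * map_poly of_int q :: 'a :: comm_ring_1 poly)"
  by (rule map_poly_mult_hom) simp_all

lemma map_poly_of_int_diff:
  "map_poly of_int (p - q) = (map_poly of_int p - map_poly of_int q :: 'a :: comm_ring_1 poly)"
  by (intro poly_eqI) (simp add: coeff_map_poly)

lemma map_poly_of_rat_mult:
  "map_poly of_rat (p * q) = (map_poly of_rat p * map_poly of_rat q :: 'a :: field_char_0 poly)"
  by (rule map_poly_mult_hom) (simp_all add: of_rat_add of_rat_mult)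

lemma map_poly_of_rat_add:
  "map_poly of_rat (p + q) = (map_poly of_rat p + map_poly of_rat q :: 'a :: field_char_0 poly)"
  by (rule map_poly_add_hom) (simp_all add: of_rat_add)

lemma map_poly_of_rat_of_int:
  "map_poly of_rat (map_poly of_int p) = (map_poly of_int p :: 'a :: field_char_0 poly)"
  by (subst map_poly_map_poly) (simp_all add: o_def)

lemma map_poly_of_real_of_int:
  "map_poly of_real (map_poly of_int p) = (map_poly of_int p :: complex poly)"
  by (subst map_poly_map_poly) (simp_all add: o_def)

lemma map_poly_of_int_eq_iff [simp]:
  "map_poly of_int p = (map_poly of_int q :: 'a :: {comm_ring_1, ring_char_0} poly) \<longleftrightarrow> p = q"
  by (auto simp: poly_eq_iff coeff_map_poly)

lemma lead_coeff_map_of_int [simp]: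
  "lead_coeff (map_poly of_int p :: 'a :: {comm_ring_1, ring_char_0} poly) = of_int (lead_coeff p)"
  by (simp add: degree_map_poly coeff_map_poly)

section \<open>Gauss's lemma for monic factors\<close>

lemma common_denominator:
  fixes p :: "rat poly"
  obtains a :: int and r :: "int poly" where "a > 0" "smult (of_int a) p = map_poly of_int r"
proof -
  have "\<exists>(a::int) (r::int poly). a > 0 \<and> smult (of_int a) p = map_poly of_int r"
  proof (induction p)
    case 0
    show ?case by (intro exI[of _ 1] exI[of _ 0]) simp
  next
    case (pCons x p)
    then obtain a :: int and r where a: "a > 0" "smult (of_int a) p = map_poly of_int r" by blast
    obtain m k :: int where k: "k > 0" "x = of_int m / of_int k"
      by (rule Rats_cases'[of x]) (auto simp: Rats_def)
    have "smult (of_int (a * k)) (pCons x p) = pCons (of_int (m * a)) (smult (of_int k) (smult (of_int a) p))"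
      using k by (simp add: field_simps)
    also have "\<dots> = map_poly of_int (pCons (m * a) (smult k r))"
      unfolding a by (simp add: map_poly_pCons map_poly_smult)
    finally show ?case using a k by (intro exI[of _ "a * k"] exI) auto
  qed
  with that show ?thesis by blast
qed

lemma content_monic:
  fixes p :: "int poly"
  assumes "lead_coeff p = 1"
  shows "content p = 1"
  using content_dvd_coeff[of p "degree p"] assms by (simp only: is_unit_content_iff)

text \<open>After clearing denominators by \<open>a\<close> and \<open>b\<close>, multiplicativity
  of the content gives \<open>content r * content s = a * b\<close>. This is also the product of the
  leading coefficients, so the primitive parts are monic and \<open>A\<close> is one of
  them.\<close>

lemma monic_rat_factor_int:
  fixes Q :: "int poly" and A B :: "rat poly"
  assumes Q: "lead_coeff Q = 1" and AB: "map_poly of_int Q = A * B" and A: "lead_coeff A = 1"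
  obtains A' where "A = map_poly of_int A'"
proof -
  have "lead_coeff A * lead_coeff B = 1"
    using Q by (simp flip: lead_coeff_mult AB)
  then have B: "lead_coeff B = 1" using A by simp
  obtain a r where a: "a > 0" "smult (of_int a) A = map_poly of_int r" by (rule common_denominator)
  obtain b s where b: "b > 0" "smult (of_int b) B = map_poly of_int s" by (rule common_denominator)
  have la: "lead_coeff r = a"
  proof -
    have "of_int (lead_coeff r) = (of_int a :: rat)"
      using A by (simp only: lead_coeff_map_of_int[symmetric] a(2)[symmetric] lead_coeff_smult mult_1_right)
    then show ?thesis by simp
  qed
  have lb: "lead_coeff s = b"
  proof -
    have "of_int (lead_coeff s) = (of_int b :: rat)"
      using B by (simp only: lead_coeff_map_of_int[symmetric] b(2)[symmetric] lead_coeff_smult mult_1_right)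
    then show ?thesis by simp
  qed
  have "map_poly of_int (smult (a * b) Q) = smult (of_int a) A * smult (of_int b) B"
    by (simp add: map_poly_smult AB mult_ac)
  also have "\<dots> = map_poly of_int (r * s)" unfolding a b by (simp add: map_poly_of_int_mult)
  finally have "smult (a * b) Q = r * s" by simp
  then have "content (smult (a * b) Q) = content r * content s" by (simp add: content_mult)
  then have c: "content r * content s = a * b"
    using a b content_monic[OF Q] by (simp add: abs_mult)
  have la': "content r * lead_coeff (primitive_part r) = a"
    using la content_times_primitive_part[of r] lead_coeff_smult by metis
  have lb': "content s * lead_coeff (primitive_part s) = b"
    using lb content_times_primitive_part[of s] lead_coeff_smult by metis
  have cpos: "content r \<ge> 0" using normalize_content[of r] by (simp add: abs_if split: if_splits)
  have "content r * content s * (lead_coeff (primitive_part r) * lead_coeff (primitive_part s)) = a * b"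
    using la' lb' by (simp add: mult_ac) (metis mult.assoc mult.commute)
  then have "lead_coeff (primitive_part r) * lead_coeff (primitive_part s) = 1"
    using a b unfolding c by simp
  moreover have "lead_coeff (primitive_part r) > 0"
    using la' a(1) cpos by (metis zero_less_mult_pos zero_less_mult_iff linorder_not_less)
  ultimately have "lead_coeff (primitive_part r) = 1"
    by (simp add: zmult_eq_1_iff)
  then have "content r = a" using la' by simp
  then have "smult (of_int a) A = smult (of_int a) (map_poly of_int (primitive_part r))"
    unfolding a using content_times_primitive_part[of r]
    by (subst map_poly_smult[symmetric]) simp_all
  then have "A = map_poly of_int (primitive_part r)" using a(1) by (simp add: smult_eq_iff)
  with that show ?thesis by blast
qed

section \<open>Minimal polynomials over the rationals\<close>

lemma minpoly_exists_dvd: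
  fixes P :: "rat poly" and x :: complex
  assumes "P \<noteq> 0" "poly (map_poly of_rat P) x = 0"
  obtains m where "is_minpoly m x" "\<And>g. poly (map_poly of_rat g) x = 0 \<Longrightarrow> m dvd g"
proof -
  \<comment> \<open>A monic element of least degree in \<open>S\<close> is wanted: division with
    remainder shows that it divides every polynomial vanishing at \<open>x\<close>, and a proper
    factor vanishing at \<open>x\<close> would contradict minimality.\<close>
  define S where "S = {p :: rat poly. p \<noteq> 0 \<and> poly (map_poly of_rat p) x = 0}"
  have "P \<in> S" using assms by (simp add: S_def)
  then obtain r where r: "r \<in> S" "\<And>g. g \<in> S \<Longrightarrow> degree r \<le> degree g"
    using ex_has_least_nat[of "\<lambda>p. p \<in> S" P degree] by blast
  define m where "m = smult (inverse (lead_coeff r)) r"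
  have lm: "lead_coeff m = 1" and dm: "degree m = degree r"
    using r(1) by (auto simp: m_def S_def)
  have mS: "m \<in> S" using r(1) by (auto simp: m_def S_def map_poly_smult of_rat_mult)
  have least: "degree m \<le> degree g" if "g \<noteq> 0" "poly (map_poly of_rat g) x = 0" for g
    using r(2)[of g] that dm by (simp add: S_def)
  have m0: "m \<noteq> 0" "poly (map_poly of_rat m) x = 0" using mS by (auto simp: S_def)
  have dvd: "m dvd g" if "poly (map_poly of_rat g) x = 0" for g
  proof (rule ccontr)
    assume "\<not> m dvd g"
    then have ne: "g mod m \<noteq> 0" by (simp add: dvd_eq_mod_eq_0)
    have "poly (map_poly of_rat (g div m * m + g mod m)) x = 0" using that by simp
    then have "poly (map_poly of_rat (g mod m)) x = 0"
      using m0 by (simp only: map_poly_of_rat_add map_poly_of_rat_mult poly_add poly_mult) simp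
    then have "degree m \<le> degree (g mod m)" using least ne by blast
    then show False using degree_mod_less'[OF m0(1) ne] by simp
  qed
  have dpos: "degree m > 0"
  proof (rule ccontr)
    assume "\<not> degree m > 0"
    then obtain c where "m = [:c:]" by (auto elim: degree_eq_zeroE)
    then show False using m0 by (auto simp: map_poly_pCons)
  qed
  have "irreducible m"
  proof (rule irreducibleI)
    show "m \<noteq> 0" by fact
    show "\<not> is_unit m" using dpos by (auto simp: is_unit_iff_degree m0)
    fix a b assume ab: "m = a * b"
    then have "poly (map_poly of_rat a) x * poly (map_poly of_rat b) x = 0"
      using m0 by (simp add: map_poly_of_rat_mult)
    moreover have ne: "a \<noteq> 0" "b \<noteq> 0" using ab m0 by auto
    ultimately have "degree m \<le> degree a \<or> degree m \<le> degree b"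
      using least by (auto simp del: of_rat_0)
    moreover have "degree m = degree a + degree b" using ab ne by (simp add: degree_mult_eq)
    ultimately show "is_unit a \<or> is_unit b" using ne by (auto simp: is_unit_iff_degree)
  qed
  with lm m0 dvd that show ?thesis by (auto simp: is_minpoly_def)
qed

text \<open>Some minimal polynomial \<open>m0\<close> divides everything that vanishes at
  \<open>x\<close>. It divides the irreducible \<open>m\<close> without being a unit, so
  \<open>m\<close> divides \<open>m0\<close> in turn.\<close>

lemma is_minpoly_dvd:
  assumes m: "is_minpoly m x" and g: "poly (map_poly of_rat g) x = 0"
  shows "m dvd g"
proof -
  have "m \<noteq> 0" using m by (auto simp: is_minpoly_def)
  then obtain m0 where m0: "is_minpoly m0 x" "\<And>g. poly (map_poly of_rat g) x = 0 \<Longrightarrow> m0 dvd g"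
    using m minpoly_exists_dvd[of m x] by (auto simp: is_minpoly_def)
  have "m0 dvd m" using m0 m by (simp add: is_minpoly_def)
  moreover have "\<not> is_unit m0" using m0(1) irreducible_not_unit by (auto simp: is_minpoly_def)
  ultimately have "m dvd m0"
    using m irreducibleD'[of m m0] by (auto simp: is_minpoly_def)
  then show ?thesis using m0(2)[OF g] by (rule dvd_trans)
qed

lemma is_minpoly_unique:
  assumes "is_minpoly m x" "is_minpoly m' x"
  shows "m = m'"
proof -
  have "m dvd m'" "m' dvd m" and monic: "lead_coeff m = 1" "lead_coeff m' = 1"
    using assms is_minpoly_dvd by (auto simp: is_minpoly_def)
  then obtain c where c: "m = m' * c" and "degree m = degree m'"
    by (metis dvdE dvd_imp_degree_le leading_coeff_0_iff order.antisym zero_neq_one)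
  moreover have "lead_coeff c = 1" using monic lead_coeff_mult[of m' c] by (simp add: c)
  moreover have "m' \<noteq> 0" "c \<noteq> 0" using monic c by auto
  ultimately have "degree c = 0" "lead_coeff c = 1" by (simp_all add: degree_mult_eq)
  then have "c = 1" by (auto elim!: degree_eq_zeroE)
  with c show ?thesis by simp
qed

lemma conjugates_eq:
  assumes "is_minpoly m x"
  shows "conjugates x = {z. poly (map_poly of_rat m) z = 0}"
  using assms is_minpoly_unique by (auto simp: conjugates_def)

lemma pderiv_map_poly_of_rat:
  "pderiv (map_poly of_rat p) = (map_poly of_rat (pderiv p) :: 'a :: field_char_0 poly)"
  by (intro poly_eqI) (simp add: coeff_pderiv coeff_map_poly of_rat_mult of_rat_add)

text \<open>At a multiple root \<open>a\<close>, \<open>m\<close> would also be the minimal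
  polynomial of \<open>a\<close> and hence divide its own nonzero derivative, which has smaller
  degree.\<close>

lemma is_minpoly_rsquarefree:
  assumes m: "is_minpoly m x"
  shows "rsquarefree (map_poly of_rat m :: complex poly)"
  unfolding rsquarefree_roots
proof (intro allI notI, elim conjE)
  fix a :: complex
  assume a: "poly (map_poly of_rat m) a = 0" "poly (pderiv (map_poly of_rat m)) a = 0"
  have ma: "is_minpoly m a" using m a by (simp add: is_minpoly_def)
  have "m dvd pderiv m"
    using is_minpoly_dvd[OF ma, of "pderiv m"] a by (simp add: pderiv_map_poly_of_rat)
  moreover have "m \<noteq> 0" "\<not> is_unit m" using m irreducible_not_unit by (auto simp: is_minpoly_def)
  then have d: "degree m > 0" by (simp add: is_unit_iff_degree)
  moreover have "pderiv m \<noteq> 0" using d by (simp add: pderiv_eq_0_iff)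
  ultimately have "degree m \<le> degree (pderiv m)" by (intro dvd_imp_degree_le)
  then show False using d by (simp add: degree_pderiv)
qed

section \<open>Kronecker's theorem\<close>

lemma coeff_bound_of_values:
  fixes A :: "complex set"
  assumes fin: "finite A"
  obtains N :: nat where "\<And>(r :: complex poly) i. degree r < card A \<Longrightarrow>
    (\<And>z. z \<in> A \<Longrightarrow> norm (poly r z) \<le> 1) \<Longrightarrow> norm (coeff r i) \<le> N"
proof -
  \<comment> \<open>The Lagrange basis of \<open>A\<close>. Values of modulus at most 1 bound the
    coefficients of the interpolant by those of the basis, a bound depending on \<open>A\<close>
    alone.\<close>
  define L where "L a = smult (1 / (\<Prod>b\<in>A - {a}. a - b)) (\<Prod>b\<in>A - {a}. [:- b, 1:])" for a
  define N where "N = nat \<lceil>\<Sum>i<card A. \<Sum>a\<in>A. norm (coeff (L a) i)\<rceil>"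
  have L: "poly (L a) z = (if z = a then 1 else 0)" if "a \<in> A" "z \<in> A" for a z
    using that fin by (auto simp: L_def poly_prod intro!: prod_zero)
  have dL: "degree (L a) < card A" if "a \<in> A" for a
  proof -
    have "degree (L a) \<le> card (A - {a})"
      unfolding L_def by (rule order.trans[OF degree_smult_le]) (simp add: degree_prod_sum_eq)
    also have "\<dots> < card A" using that fin by (rule card_Diff1_less[rotated])
    finally show ?thesis .
  qed
  show ?thesis
  proof (rule that[of N])
    fix r :: "complex poly" and i
    assume r: "degree r < card A" "\<And>z. z \<in> A \<Longrightarrow> norm (poly r z) \<le> 1"
    have "r = (\<Sum>a\<in>A. smult (poly r a) (L a))"
    proof (rule poly_eqI_degree[of A])
      show "poly r z = poly (\<Sum>a\<in>A. smult (poly r a) (L a)) z" if "z \<in> A" for z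
        using that fin by (simp add: poly_sum L if_distrib[of "(*) _"] sum.delta cong: if_cong)
      have "degree (\<Sum>a\<in>A. smult (poly r a) (L a)) \<le> card A - 1"
        using dL by (intro degree_sum_le fin order.trans[OF degree_smult_le]) force
      then show "degree (\<Sum>a\<in>A. smult (poly r a) (L a)) < card A" using r(1) by linarith
    qed (rule r)
    then have "coeff r i = (\<Sum>a\<in>A. poly r a * coeff (L a) i)"
      using coeff_sum[of "\<lambda>a. smult (poly r a) (L a)" A i] by simp
    also have "norm \<dots> \<le> (\<Sum>a\<in>A. norm (poly r a * coeff (L a) i))" by (rule norm_sum)
    also have "\<dots> \<le> (\<Sum>a\<in>A. norm (coeff (L a) i))"
      using r(2) by (intro sum_mono) (auto simp: norm_mult intro: mult_left_le_one_le)
    finally have *: "norm (coeff r i) \<le> (\<Sum>a\<in>A. norm (coeff (L a) i))" .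
    show "norm (coeff r i) \<le> N"
    proof (cases "i < card A")
      case True
      then have "(\<Sum>a\<in>A. norm (coeff (L a) i)) \<le> (\<Sum>i<card A. \<Sum>a\<in>A. norm (coeff (L a) i))"
        by (intro member_le_sum) (auto intro: sum_nonneg)
      with * show ?thesis unfolding N_def by linarith
    next
      case False
      then show ?thesis using r(1) by (simp add: coeff_eq_0)
    qed
  qed
qed

lemma finite_int_polys_bounded:
  "finite {r :: int poly. degree r < n \<and> (\<forall>i. \<bar>coeff r i\<bar> \<le> int N)}"
proof (rule finite_subset)
  show "{r. degree r < n \<and> (\<forall>i. \<bar>coeff r i\<bar> \<le> int N)}
      \<subseteq> Poly ` {xs. set xs \<subseteq> {- int N..int N} \<and> length xs = n}"
  proof
    fix r :: "int poly"
    assume r: "r \<in> {r. degree r < n \<and> (\<forall>i. \<bar>coeff r i\<bar> \<le> int N)}"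
    have "r = Poly (map (coeff r) [0..<n])"
      using r by (intro poly_eqI) (auto simp: nth_default_def coeff_eq_0)
    moreover have "set (map (coeff r) [0..<n]) \<subseteq> {- int N..int N}"
      using r by (auto simp: abs_le_iff minus_le_iff)
    ultimately show "r \<in> Poly ` {xs. set xs \<subseteq> {- int N..int N} \<and> length xs = n}"
      by (intro image_eqI[of _ _ "map (coeff r) [0..<n]"]) auto
  qed
  show "finite (Poly ` {xs. set xs \<subseteq> {- int N..int N} \<and> length xs = n})"
    by (intro finite_imageI finite_lists_length_eq) simp
qed

text \<open>Pseudo-division multiplies the dividend by a power of the leading coefficient, here 1,
  so division with remainder stays within the coefficient ring. Positive degree covers a zero
  remainder.\<close>

lemma monom_mod_monic:
  fixes f :: "'a :: idom poly"
  assumes monic: "lead_coeff f = 1" and deg: "degree f > 0"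
  shows "\<exists>u r. monom 1 k = f * u + r \<and> degree r < degree f"
proof -
  have "f \<noteq> 0" using monic by auto
  obtain u r where "pseudo_divmod (monom 1 k) f = (u, r)" by (cases "pseudo_divmod (monom 1 k) f")
  from pseudo_divmod[OF \<open>f \<noteq> 0\<close> this] monic deg
  have "monom 1 k = f * u + r" "degree r < degree f" by auto
  then show ?thesis by blast
qed

text \<open>Kronecker: the remainders of the powers of \<open>X\<close> modulo the minimal polynomial \<open>f\<close> have bounded
  values at the roots of \<open>f\<close>, hence bounded integer coefficients, so two of them coincide.\<close>

lemma kronecker_root_of_unity:
  fixes C :: "int poly" and x :: complex
  assumes monic: "lead_coeff C = 1"
    and disc: "\<And>z :: complex. poly (map_poly of_int C) z = 0 \<Longrightarrow> norm z \<le> 1"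
    and x: "poly (map_poly of_int C) x = 0" "x \<noteq> 0"
  shows "\<exists>k>0. x ^ k = 1"
proof -
  let ?C = "map_poly of_int C :: rat poly"
  have "?C \<noteq> map_poly of_int 0" using monic unfolding map_poly_of_int_eq_iff by auto
  then have "?C \<noteq> 0" by simp
  moreover have "poly (map_poly of_rat ?C) x = 0" using x by (simp add: map_poly_of_rat_of_int)
  ultimately obtain m where m: "is_minpoly m x"
    and "m dvd ?C"
    using minpoly_exists_dvd by metis
  then obtain B where B: "?C = m * B" by (elim dvdE)
  have lm: "lead_coeff m = 1" using m by (simp add: is_minpoly_def)
  obtain f where f: "m = map_poly of_int f" by (rule monic_rat_factor_int[OF monic B lm])
  define F where "F = (map_poly of_int f :: complex poly)"
  have F: "map_poly of_rat m = F" by (simp add: F_def f map_poly_of_rat_of_int)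
  have lf: "lead_coeff f = 1"
    using lm unfolding f lead_coeff_map_of_int by simp
  have sq: "rsquarefree F" using is_minpoly_rsquarefree[OF m] by (simp add: F)
  have "F \<noteq> 0" using sq by (simp add: rsquarefree_def)
  define A where "A = {z. poly F z = 0}"
  have finA: "finite A" unfolding A_def using \<open>F \<noteq> 0\<close> by (rule poly_roots_finite)
  \<comment> \<open>Being squarefree, \<open>F\<close> has as many distinct roots as its degree, so
    remainders modulo \<open>f\<close> fall under the interpolation bound.\<close>
  have card: "card A = degree f"
  proof -
    have "degree F = degree (\<Prod>z\<in>A. [:- z, 1:])"
      using \<open>F \<noteq> 0\<close> by (subst complex_poly_decompose_rsquarefree[OF sq, symmetric]) (simp add: A_def)
    then show ?thesis by (simp add: degree_prod_sum_eq F_def degree_map_poly)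
  qed
  have xA: "x \<in> A" using m by (simp add: A_def F is_minpoly_def)
  then have deg: "degree f > 0" using card finA by (metis card_gt_0_iff empty_iff)
  have small: "norm z \<le> 1" if "z \<in> A" for z
  proof (rule disc)
    have "map_poly of_int C = F * map_poly of_rat B"
      unfolding F[symmetric] map_poly_of_rat_mult[symmetric] B[symmetric]
      by (simp add: map_poly_of_rat_of_int)
    then show "poly (map_poly of_int C) z = 0" using that by (simp add: A_def)
  qed
  have "\<forall>k. \<exists>u r. monom 1 k = f * u + r \<and> degree r < degree f"
    using monom_mod_monic[OF lf deg] by blast
  then obtain u r where r: "\<And>k. monom 1 k = f * u k + r k" "\<And>k. degree (r k) < degree f"
    by metis
  have val: "poly (map_poly of_int (r k)) z = z ^ k" if "z \<in> A" for k z
  proof -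
    have "z ^ k = poly (map_poly of_int (monom 1 k)) z" by (simp add: map_poly_monom poly_monom)
    also have "\<dots> = poly F z * poly (map_poly of_int (u k)) z + poly (map_poly of_int (r k)) z"
      unfolding r(1) F_def by (simp add: map_poly_of_int_add map_poly_of_int_mult)
    finally show ?thesis using that by (simp add: A_def)
  qed
  obtain N where N: "\<And>(r :: complex poly) i. degree r < card A \<Longrightarrow>
    (\<And>z. z \<in> A \<Longrightarrow> norm (poly r z) \<le> 1) \<Longrightarrow> norm (coeff r i) \<le> real N"
    by (rule coeff_bound_of_values[OF finA]) blast
  have "\<bar>coeff (r k) i\<bar> \<le> int N" for k i
  proof -
    have "norm (coeff (map_poly of_int (r k) :: complex poly) i) \<le> real N"
    proof (rule N)
      show "degree (map_poly of_int (r k) :: complex poly) < card A"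
        using r(2) by (simp add: degree_map_poly card)
      show "norm (poly (map_poly of_int (r k)) z) \<le> 1" if "z \<in> A" for z
        using small[OF that] by (simp add: val[OF that] norm_power power_le_one)
    qed
    then show ?thesis by (simp add: coeff_map_poly)
  qed
  then have "range r \<subseteq> {r. degree r < degree f \<and> (\<forall>i. \<bar>coeff r i\<bar> \<le> int N)}"
    using r(2) by auto
  then have "finite (range r)" using finite_int_polys_bounded finite_subset by blast
  then have "\<not> inj r" using finite_imageD infinite_UNIV_nat by blast
  then obtain k l where "k < l" "r k = r l"
    by (metis injI linorder_neqE_nat)
  then have "x ^ k = x ^ l" using val[OF xA, of k] val[OF xA, of l] by simp
  moreover have "x ^ l = x ^ k * x ^ (l - k)" using \<open>k < l\<close> by (simp flip: power_add)
  ultimately have "x ^ (l - k) = 1" using x(2) by simp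
  then show ?thesis using \<open>k < l\<close> by (intro exI[of _ "l - k"]) simp
qed

subsection \<open>The outer zero\<close>

text \<open>The enumeration \<open>root\<close> lists zeros with multiplicity, so this is Vieta's
  formula for the constant coefficient.\<close>

lemma norm_poly_0_eq_prod_roots:
  fixes F :: "complex poly"
  assumes "lead_coeff F = 1"
  obtains root :: "nat \<Rightarrow> complex" where "\<And>i. i < degree F \<Longrightarrow> poly F (root i) = 0"
    and "norm (poly F 0) = (\<Prod>i<degree F. norm (root i))"
proof -
  obtain root where root: "smult (lead_coeff F) (\<Prod>i<degree F. [:- root i, 1:]) = F"
    by (rule complex_poly_decompose')
  have pF: "poly F z = (\<Prod>i<degree F. z - root i)" for z
    using arg_cong[OF root, of "\<lambda>F. poly F z"] assms by (simp add: poly_prod)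
  show ?thesis
    by (rule that[of root]) (auto simp: pF prod_norm[symmetric])
qed

lemma circular_interlacing_degree_eq:
  assumes "circular_interlacing p q"
  shows "degree p = degree q"
proof -
  have "degree (map_poly complex_of_real p) = degree (map_poly complex_of_real q)"
    using assms unfolding circular_interlacing_def zeros_interlace_on_circle_def
    by (auto simp flip: size_proots_complex)
  then show ?thesis by (simp add: degree_map_poly)
qed

text \<open>Intermediate value theorem towards infinity. If \<open>f\<close> vanishes at 1, a
  negative derivative makes it dip below 0 just to the right.\<close>

lemma real_root_beyond_1:
  fixes f :: "real poly"
  assumes lead: "lead_coeff f > 0"
    and "poly f 1 < 0 \<or> poly f 1 = 0 \<and> poly (pderiv f) 1 < 0"
  obtains t where "t > 1" "poly f t = 0"
proof -
  obtain s where s: "s \<ge> 1" "poly f s < 0"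
  proof (cases "poly f 1 < 0")
    case False
    with assms have *: "poly f 1 = 0" "poly (pderiv f) 1 < 0" by auto
    obtain d where "d > 0" "\<And>h. h > 0 \<Longrightarrow> h < d \<Longrightarrow> poly f (1 + h) < poly f 1"
      using DERIV_neg_dec_right[OF poly_DERIV *(2)] by blast
    then have "poly f (1 + d / 2) < 0" using * by simp
    with \<open>d > 0\<close> show ?thesis by (intro that[of "1 + d / 2"]) auto
  qed (auto intro: that)
  obtain N where N: "\<And>x. x \<ge> N \<Longrightarrow> poly f x \<ge> lead_coeff f"
    using poly_pinfty_gt_lc[OF lead] by blast
  have "poly f (max N (s + 1)) > 0" using N[of "max N (s + 1)"] lead by simp
  then obtain t where "s < t" "poly f t = 0"
    using poly_IVT_pos[of s "max N (s + 1)" f] s by (auto simp: less_max_iff_disj)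
  with s show ?thesis by (intro that[of t]) auto
qed

lemma poly_map_of_int_of_real:
  "poly (map_poly of_int p) (complex_of_real x) = of_real (poly (map_poly of_int p) x)"
  using poly_map_poly_hom[of complex_of_real "map_poly of_int p" x]
  by (simp add: map_poly_of_real_of_int)

lemma poly_map_of_int_of_int:
  "poly (map_poly of_int p) (of_int x :: 'a :: comm_ring_1) = of_int (poly p x)"
  by (rule poly_map_poly_hom) simp_all

lemma pderiv_map_poly_of_int:
  "pderiv (map_poly of_int p) = (map_poly of_int (pderiv p) :: 'a :: field_char_0 poly)"
proof (rule poly_eqI)
  fix n
  show "coeff (pderiv (map_poly of_int p)) n = (coeff (map_poly of_int (pderiv p)) n :: 'a)"
    by (simp only: coeff_pderiv coeff_map_poly of_int_0 of_int_mult of_int_of_nat_eq)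
qed

section \<open>Integral interlacing pairs and the polynomials \<open>T e\<close>\<close>

locale interlacing_int_pair =
  fixes p q :: "int poly"
  assumes interlacing: "circular_interlacing (map_poly of_int p) (map_poly of_int q)"
    and monic: "lead_coeff p = 1"
begin

abbreviation (input) cpoly :: "int poly \<Rightarrow> complex poly" where
  "cpoly f \<equiv> map_poly of_int f"

text \<open>The parameter \<open>e\<close> is the \<epsilon> of the solution lemmas;
  \<open>e = 0\<close> belongs to the Salem case and \<open>e = 1\<close> to the Pisot case.\<close>

definition T :: "int \<Rightarrow> int poly" where
  "T e = [:-1, -e, 1:] * p - [:0, 1:] * q"

lemma poly_T: "poly (cpoly (T e)) z = (z\<^sup>2 - of_int e * z - 1) * poly (cpoly p) z - z * poly (cpoly q) z"
  unfolding T_def map_poly_of_int_diff map_poly_of_int_mult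
  by (simp add: map_poly_pCons power2_eq_square algebra_simps)

lemma root_norm: "poly (cpoly p) z = 0 \<or> poly (cpoly q) z = 0 \<Longrightarrow> norm z = 1"
  using interlacing by (auto simp: circular_interlacing_def map_poly_of_real_of_int)

text \<open>A Bezout identity over the reals persists over the complex numbers.\<close>

lemma no_common_root: "\<not> (poly (cpoly p) z = 0 \<and> poly (cpoly q) z = 0)"
proof -
  have "coprime (map_poly of_int p :: real poly) (map_poly of_int q)"
    using interlacing by (simp add: circular_interlacing_def)
  then obtain u v :: "real poly" where "u * map_poly of_int p + v * map_poly of_int q = 1"
    using bezout_coefficients_fst_snd[of "map_poly of_int p :: real poly" "map_poly of_int q"] by auto
  then have "map_poly complex_of_real (u * map_poly of_int p + v * map_poly of_int q) = 1" by simp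
  then have "map_poly complex_of_real u * cpoly p + map_poly complex_of_real v * cpoly q = 1"
    by (simp add: map_poly_add_hom map_poly_mult_hom map_poly_of_real_of_int)
  then have "poly (map_poly complex_of_real u * cpoly p + map_poly complex_of_real v * cpoly q) z = 1"
    by simp
  then show ?thesis by auto
qed

lemma degree_q: "degree q = degree p"
  using circular_interlacing_degree_eq[OF interlacing] by (simp add: degree_map_poly)

lemma p_nonzero: "p \<noteq> 0" using monic by auto

lemma lead_coeff_T: "lead_coeff (T e) = 1"
proof -
  have "degree ([:-1, -e, 1:] * p) = degree p + 2" using p_nonzero by (subst degree_mult_eq) auto
  moreover have "degree ([:0, 1:] * q) < degree p + 2"
    using degree_mult_le[of "[:0, 1:]" q] degree_q by simp
  ultimately have "lead_coeff (T e) = lead_coeff ([:-1, -e, 1:] * p)"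
    unfolding T_def diff_conv_add_uminus add.commute[of _ "- _"]
    by (intro lead_coeff_add_le) (simp only: degree_minus)
  then show ?thesis using monic by (simp only: lead_coeff_mult) simp
qed

text \<open>The constant coefficient of \<open>T e\<close> is that of \<open>- p\<close>, and all
  zeros of the monic \<open>p\<close> have modulus 1.\<close>

lemma abs_T_0: "\<bar>poly (T e) 0\<bar> = 1"
proof -
  have lp: "lead_coeff (cpoly p) = 1" using monic by (simp only: lead_coeff_map_of_int of_int_1)
  obtain root where root: "\<And>i. i < degree (cpoly p) \<Longrightarrow> poly (cpoly p) (root i) = 0"
    "norm (poly (cpoly p) 0) = (\<Prod>i<degree (cpoly p). norm (root i))"
    by (rule norm_poly_0_eq_prod_roots[OF lp]) blast
  then have "norm (poly (cpoly p) (of_int 0)) = 1" using root_norm by simp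
  then have "real_of_int \<bar>poly p 0\<bar> = 1" unfolding poly_map_of_int_of_int by simp
  then have "\<bar>poly p 0\<bar> = 1" by linarith
  then show ?thesis by (simp add: T_def)
qed

lemma T_0: "poly (cpoly (T e)) 0 \<noteq> 0"
  using abs_T_0[of e] poly_map_of_int_of_int[of "T e" 0, where ?'a = complex] by auto

text \<open>If \<open>p\<close> vanished too, \<open>z * q z\<close> would be 0 with
  \<open>z\<close> nonzero, and \<open>p\<close> and \<open>q\<close> would share a zero.\<close>

lemma p_nonzero_at_T_root: "poly (cpoly (T e)) z = 0 \<Longrightarrow> poly (cpoly p) z \<noteq> 0"
  using T_0[of e] no_common_root[of z] by (auto simp: poly_T)

lemma root_equation:
  obtains n \<alpha> lam where "positive_circle_sum n \<alpha> lam"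
    and "\<And>z. poly (cpoly p) z = 0 \<longleftrightarrow> (\<exists>i<n. z = \<alpha> i)"
    and "\<And>z. poly (cpoly p) z \<noteq> 0 \<Longrightarrow> poly (cpoly q) z = poly (cpoly p) z * positive_circle_sum.H n \<alpha> lam z"
    and "\<And>e z. z \<noteq> 0 \<Longrightarrow> poly (cpoly p) z \<noteq> 0 \<Longrightarrow>
      poly (cpoly (T e)) z = z * poly (cpoly p) z * (z - 1 / z - of_int e - positive_circle_sum.H n \<alpha> lam z)"
proof -
  obtain n \<alpha> lam where *: "positive_circle_sum n \<alpha> lam"
    "\<And>z. poly (cpoly p) z = 0 \<longleftrightarrow> (\<exists>i<n. z = \<alpha> i)"
    "\<And>z. poly (cpoly p) z \<noteq> 0 \<Longrightarrow> poly (cpoly q) z = poly (cpoly p) z * positive_circle_sum.H n \<alpha> lam z"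
    by (rule interlacing_partial_fractions[OF interlacing, unfolded map_poly_of_real_of_int]) blast
  show ?thesis
    by (rule that[OF *]) (auto simp: poly_T * power2_eq_square field_simps)
qed

lemma outer_root_unique:
  assumes e: "e \<ge> 0" and z: "norm z > 1" "poly (cpoly (T e)) z = 0"
    and w: "norm w > 1" "poly (cpoly (T e)) w = 0"
  shows "z = w"
proof -
  obtain n \<alpha> lam where H: "positive_circle_sum n \<alpha> lam"
    and eq: "\<And>e z. z \<noteq> 0 \<Longrightarrow> poly (cpoly p) z \<noteq> 0 \<Longrightarrow>
      poly (cpoly (T e)) z = z * poly (cpoly p) z * (z - 1 / z - of_int e - positive_circle_sum.H n \<alpha> lam z)"
    by (rule root_equation) blast
  interpret positive_circle_sum n \<alpha> lam by (rule H)
  have "u - 1 / u - of_real (of_int e) = H u" if "norm u > 1" "poly (cpoly (T e)) u = 0" for u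
    using eq[of u e] p_nonzero_at_T_root[OF that(2)] that by fastforce
  then show ?thesis using solution_unique[of "of_int e" z w] z w e by auto
qed

lemma outer_root_simple:
  assumes e: "e \<ge> 0" and t: "t > 1" "poly (cpoly (T e)) (of_real t) = 0"
  shows "poly (pderiv (cpoly (T e))) (of_real t) \<noteq> 0"
proof -
  let ?t = "complex_of_real t"
  obtain n \<alpha> lam where H: "positive_circle_sum n \<alpha> lam"
    and eq: "\<And>e z. z \<noteq> 0 \<Longrightarrow> poly (cpoly p) z \<noteq> 0 \<Longrightarrow>
      poly (cpoly (T e)) z = z * poly (cpoly p) z * (z - 1 / z - of_int e - positive_circle_sum.H n \<alpha> lam z)"
    by (rule root_equation) blast
  interpret positive_circle_sum n \<alpha> lam by (rule H)
  let ?F = "\<lambda>z. z - 1 / z - of_real (of_int e) - H z"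
  have pt: "poly (cpoly p) ?t \<noteq> 0" by (rule p_nonzero_at_T_root[OF t(2)])
  have Ft: "?F ?t = 0" using eq[of ?t e] pt t by auto
  obtain D where D: "(?F has_field_derivative D) (at ?t)" "D \<noteq> 0"
    by (rule solution_simple[of "of_int e" t]) (use Ft e t in auto)
  \<comment> \<open>In the product rule the other term carries the factor \<open>?F ?t = 0\<close>.
    The factorization of \<open>T e\<close> is available on the open set where
    \<open>z * p z\<close> is nonzero, which is enough for the derivative at
    \<open>t\<close>.\<close>
  have "((\<lambda>z. z * poly (cpoly p) z * ?F z) has_field_derivative ?t * poly (cpoly p) ?t * D) (at ?t)"
    using DERIV_mult[OF poly_DERIV[of "[:0, 1:] * cpoly p" ?t] D(1)] Ft by (simp add: mult_ac)
  moreover have "open {z. poly ([:0, 1:] * cpoly p) z \<noteq> 0}"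
    by (intro open_Collect_neq continuous_intros)
  ultimately have "(poly (cpoly (T e)) has_field_derivative ?t * poly (cpoly p) ?t * D) (at ?t)"
    by (rule has_field_derivative_transform_within_open) (use pt t eq[of _ e] in auto)
  then have "poly (pderiv (cpoly (T e))) ?t = ?t * poly (cpoly p) ?t * D"
    using DERIV_unique poly_DERIV by blast
  then show ?thesis using pt t D by simp
qed

text \<open>On the circle \<open>1 / z = cnj z\<close>, so \<open>z - 1 / z\<close> and
  \<open>H z\<close> are both purely imaginary and the real part of the equation reads
  \<open>e = 0\<close>.\<close>

lemma no_root_on_circle:
  assumes "e \<noteq> 0" "poly (cpoly (T e)) z = 0"
  shows "norm z \<noteq> 1"
proof
  assume z: "norm z = 1"
  obtain n \<alpha> lam where H: "positive_circle_sum n \<alpha> lam"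
    and roots: "\<And>z. poly (cpoly p) z = 0 \<longleftrightarrow> (\<exists>i<n. z = \<alpha> i)"
    and eq: "\<And>e z. z \<noteq> 0 \<Longrightarrow> poly (cpoly p) z \<noteq> 0 \<Longrightarrow>
      poly (cpoly (T e)) z = z * poly (cpoly p) z * (z - 1 / z - of_int e - positive_circle_sum.H n \<alpha> lam z)"
    by (rule root_equation) blast
  interpret positive_circle_sum n \<alpha> lam by (rule H)
  have pz: "poly (cpoly p) z \<noteq> 0" by (rule p_nonzero_at_T_root[OF assms(2)])
  have "z \<noteq> 0" using z by auto
  then have "z - 1 / z - of_int e = H z" using eq[of z e] pz assms by auto
  moreover have "1 / z = cnj z"
    using z \<open>z \<noteq> 0\<close> complex_norm_square[of z] by (simp add: field_simps)
  ultimately have "H z = z - cnj z - of_real (of_int e)" by simp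
  then have "Re (H z) = - of_int e" by simp
  moreover have "Re (H z) = 0" using Re_H_on_circle z pz roots by blast
  ultimately show False using assms(1) by simp
qed

text \<open>Both \<open>z - 1 / z\<close> and \<open>H\<close> turn into minus their conjugates
  under reflection. Points of the circle are fixed; off it the reflected point is no zero of
  \<open>p\<close>, so the equation applies there.\<close>

lemma root_reflect:
  assumes "poly (cpoly (T 0)) z = 0"
  shows "poly (cpoly (T 0)) (1 / cnj z) = 0"
proof -
  obtain n \<alpha> lam where H: "positive_circle_sum n \<alpha> lam"
    and roots: "\<And>z. poly (cpoly p) z = 0 \<longleftrightarrow> (\<exists>i<n. z = \<alpha> i)"
    and eq: "\<And>e z. z \<noteq> 0 \<Longrightarrow> poly (cpoly p) z \<noteq> 0 \<Longrightarrow>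
      poly (cpoly (T e)) z = z * poly (cpoly p) z * (z - 1 / z - of_int e - positive_circle_sum.H n \<alpha> lam z)"
    by (rule root_equation) blast
  interpret positive_circle_sum n \<alpha> lam by (rule H)
  have pz: "poly (cpoly p) z \<noteq> 0" by (rule p_nonzero_at_T_root[OF assms])
  have z: "z \<noteq> 0" using assms T_0 by auto
  have Hz: "H z = z - 1 / z" using eq[of z 0] pz z assms by auto
  show ?thesis
  proof (cases "norm z = 1")
    case True
    then have "1 / cnj z = z" using z complex_norm_square[of z] by (simp add: field_simps)
    then show ?thesis using assms by simp
  next
    case False
    have "norm (1 / cnj z) \<noteq> 1" using False z by (simp add: norm_divide field_simps)
    then have p': "poly (cpoly p) (1 / cnj z) \<noteq> 0" using root_norm by blast
    have "H (1 / cnj z) = - cnj (H z)" using H_reflect[OF z] pz roots by blast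
    then show ?thesis using eq[of "1 / cnj z" 0] p' z by (simp add: Hz)
  qed
qed

text \<open>If \<open>p\<close> is nonzero at 1, the quotient of the integers
  \<open>poly q 1\<close> and \<open>poly p 1\<close> is \<open>H 1\<close>, which is purely
  imaginary; so it is 0.\<close>

lemma root_at_1: "poly p 1 = 0 \<or> poly q 1 = 0"
proof (cases "poly p 1 = 0")
  case False
  obtain n \<alpha> lam where H: "positive_circle_sum n \<alpha> lam"
    and roots: "\<And>z. poly (cpoly p) z = 0 \<longleftrightarrow> (\<exists>i<n. z = \<alpha> i)"
    and q: "\<And>z. poly (cpoly p) z \<noteq> 0 \<Longrightarrow> poly (cpoly q) z = poly (cpoly p) z * positive_circle_sum.H n \<alpha> lam z"
    by (rule root_equation) blast
  interpret positive_circle_sum n \<alpha> lam by (rule H)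
  have int: "poly (cpoly f) 1 = of_int (poly f 1)" for f
    using poly_map_of_int_of_int[of f 1, where ?'a = complex] by simp
  have p1: "poly (cpoly p) 1 \<noteq> 0" using False by (simp add: int)
  then have "Re (H 1) = 0" using Re_H_on_circle[of 1] roots by auto
  moreover have "complex_of_real (of_int (poly q 1)) = of_real (of_int (poly p 1)) * H 1"
    using q[OF p1] by (simp add: int)
  then have "Re (of_real (of_int (poly q 1))) = Re (of_real (of_int (poly p 1)) * H 1)" by simp
  ultimately show ?thesis by simp
qed simp

text \<open>With a positive leading coefficient, a negative value at 1 would force a real zero
  beyond 1, off the circle.\<close>

lemma nonneg_at_1: "poly p 1 \<ge> 0" "poly q 1 \<ge> 0" "poly p 1 \<noteq> 0 \<or> poly q 1 \<noteq> 0"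
proof -
  have *: "poly f 1 \<ge> 0"
    if lead: "lead_coeff f > 0" and roots: "\<And>z. poly (cpoly f) z = 0 \<Longrightarrow> norm z = 1" for f
  proof (rule ccontr)
    assume "\<not> poly f 1 \<ge> 0"
    then have "poly (map_poly real_of_int f) 1 < 0"
      using poly_map_of_int_of_int[of f 1, where ?'a = real] by simp
    moreover have "lead_coeff (map_poly real_of_int f) > 0"
      using lead by (simp only: lead_coeff_map_of_int of_int_0_less_iff)
    ultimately obtain t where "t > 1" "poly (map_poly real_of_int f) t = 0"
      using real_root_beyond_1 by blast
    then show False using roots[of "of_real t"] by (simp add: poly_map_of_int_of_real)
  qed
  have "lead_coeff (map_poly real_of_int q) > 0"
    using interlacing by (simp add: circular_interlacing_def)
  then have "lead_coeff q > 0" by (simp only: lead_coeff_map_of_int of_int_0_less_iff)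
  with monic show "poly p 1 \<ge> 0" "poly q 1 \<ge> 0" using root_norm by (auto intro!: *)
  show "poly p 1 \<noteq> 0 \<or> poly q 1 \<noteq> 0"
    using no_common_root[of 1] poly_map_of_int_of_int[of p 1, where ?'a = complex]
      poly_map_of_int_of_int[of q 1, where ?'a = complex] by auto
qed

lemma outer_root_exists:
  assumes "poly (T e) 1 < 0 \<or> poly (T e) 1 = 0 \<and> poly (pderiv (T e)) 1 < 0"
  obtains t where "t > 1" "poly (cpoly (T e)) (of_real t) = 0"
proof -
  have int: "poly (map_poly real_of_int f) 1 = of_int (poly f 1)" for f
    using poly_map_of_int_of_int[of f 1, where ?'a = real] by simp
  have "lead_coeff (map_poly real_of_int (T e)) > 0"
    using lead_coeff_T[of e] by (simp only: lead_coeff_map_of_int of_int_1 zero_less_one)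
  moreover have "poly (map_poly real_of_int (T e)) 1 < 0 \<or>
      poly (map_poly real_of_int (T e)) 1 = 0 \<and> poly (pderiv (map_poly real_of_int (T e))) 1 < 0"
    using assms by (simp add: int pderiv_map_poly_of_int)
  ultimately obtain t where "t > 1" "poly (map_poly real_of_int (T e)) t = 0"
    by (rule real_root_beyond_1)
  with that show ?thesis by (simp add: poly_map_of_int_of_real)
qed

lemma minpoly_factorization:
  assumes e: "e \<ge> 0" and t: "t > 1" "poly (cpoly (T e)) (of_real t) = 0"
  obtains f C where "T e = f * C" "is_minpoly (map_poly of_int f) (of_real t)"
    "lead_coeff f = 1" "lead_coeff C = 1"
    "\<And>z. poly (cpoly C) z = 0 \<Longrightarrow> norm z \<le> 1"
    "\<And>z. poly (cpoly f) z = 0 \<Longrightarrow> z \<noteq> of_real t \<Longrightarrow> norm z \<le> 1"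
    "\<bar>poly f 0\<bar> = 1" "\<bar>poly C 0\<bar> = 1"
proof -
  let ?T = "map_poly of_int (T e) :: rat poly"
  have "?T \<noteq> map_poly of_int 0" using lead_coeff_T[of e] unfolding map_poly_of_int_eq_iff by auto
  then have "?T \<noteq> 0" by simp
  moreover have "poly (map_poly of_rat ?T) (complex_of_real t) = 0"
    using t by (simp add: map_poly_of_rat_of_int)
  ultimately obtain m where m: "is_minpoly m (of_real t)" "m dvd ?T"
    using minpoly_exists_dvd by metis
  then obtain B where B: "?T = m * B" by (elim dvdE)
  have lm: "lead_coeff m = 1" using m by (simp add: is_minpoly_def)
  have "lead_coeff ?T = 1" using lead_coeff_T by (simp only: lead_coeff_map_of_int of_int_1 zero_less_one)
  then have lB: "lead_coeff B = 1" using lm by (simp add: B lead_coeff_mult)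
  obtain f where f: "m = map_poly of_int f" by (rule monic_rat_factor_int[OF lead_coeff_T B lm])
  obtain C where C: "B = map_poly of_int C"
    by (rule monic_rat_factor_int[OF lead_coeff_T _ lB, of e m]) (simp add: B mult.commute)
  have "?T = map_poly of_int (f * C)" unfolding B f C by (simp only: map_poly_of_int_mult)
  then have TfC: "T e = f * C" by simp
  have cT: "cpoly (T e) = cpoly f * cpoly C" unfolding TfC by (rule map_poly_of_int_mult)
  have ft: "poly (cpoly f) (of_real t) = 0"
    using m by (simp add: is_minpoly_def f map_poly_of_rat_of_int)
  have outer: "z = of_real t" if "poly (cpoly f) z = 0 \<or> poly (cpoly C) z = 0" "norm z > 1" for z
    using outer_root_unique[OF e that(2) _ _ t(2)] t that cT by auto
  have "\<bar>poly f 0\<bar> * \<bar>poly C 0\<bar> = 1" using abs_T_0[of e] by (simp add: TfC abs_mult)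
  then have "\<bar>poly f 0\<bar> = 1" "\<bar>poly C 0\<bar> = 1" by (auto simp: zmult_eq_1_iff)
  moreover have "norm z \<le> 1" if "poly (cpoly C) z = 0" for z
  \<comment> \<open>A zero of \<open>C\<close> outside the disc must be \<open>t\<close>, which is
    also a zero of \<open>f\<close>; then \<open>t\<close> would be a double zero of
    \<open>T e\<close>.\<close>
  proof (rule ccontr)
    assume "\<not> norm z \<le> 1"
    then have "poly (cpoly C) (of_real t) = 0" using outer[of z] that by auto
    then have "poly (pderiv (cpoly (T e))) (of_real t) = 0"
      unfolding cT using ft by (simp add: pderiv_mult)
    then show False using outer_root_simple[OF e t] by simp
  qed
  moreover have "norm z \<le> 1" if "poly (cpoly f) z = 0" "z \<noteq> of_real t" for z
    using outer[of z] that by force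
  moreover have "lead_coeff f = 1" using lm unfolding f lead_coeff_map_of_int by simp
  moreover have "lead_coeff C = 1" using lB unfolding C lead_coeff_map_of_int by simp
  ultimately show ?thesis using TfC m(1)[unfolded f] by (intro that[of f C])
qed

section \<open>Cyclotomic factors, Salem numbers and Pisot numbers\<close>

lemma cyclotomic_p: "cyclotomic_poly p"
  unfolding cyclotomic_poly_def
proof (intro conjI allI impI)
  fix z :: complex assume z: "poly (map_poly of_int p) z = 0"
  then have "z \<noteq> 0" using root_norm by force
  with z monic show "\<exists>k>0. z ^ k = 1"
    by (intro kronecker_root_of_unity) (auto simp: root_norm)
qed (rule monic)

lemma salem_part:
  assumes "poly p 1 = 0 \<or> poly q 1 = 0 \<and> 2 * poly p 1 - poly (pderiv q) 1 < 0"
  shows "\<exists>(t::real) (m::rat poly) (C::int poly).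
        (salem_number t \<or> reciprocal_pisot_number t) \<and>
        is_minpoly m (of_real t) \<and> cyclotomic_poly C \<and>
        map_poly of_int (T 0) = m * map_poly of_int C"
proof -
  have "poly (T 0) 1 = - poly q 1" "poly (pderiv (T 0)) 1 = 2 * poly p 1 - poly q 1 - poly (pderiv q) 1"
    unfolding T_def pderiv_diff pderiv_mult by (simp_all add: pderiv_pCons algebra_simps)
  \<comment> \<open>If \<open>p\<close> vanishes at 1, then \<open>q\<close> is positive there and
    the value is negative. If \<open>q\<close> does, the value is 0 and the derivative is the
    quantity assumed negative.\<close>
  then have "poly (T 0) 1 < 0 \<or> poly (T 0) 1 = 0 \<and> poly (pderiv (T 0)) 1 < 0"
    using assms nonneg_at_1 by auto
  then obtain t where t: "t > 1" "poly (cpoly (T 0)) (of_real t) = 0"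
    by (rule outer_root_exists)
  obtain f C where fC: "T 0 = f * C" and m: "is_minpoly (map_poly of_int f) (complex_of_real t)"
    and lf: "lead_coeff f = 1" and lC: "lead_coeff C = 1"
    and rC: "\<And>z. poly (cpoly C) z = 0 \<Longrightarrow> norm z \<le> 1"
    and rf: "\<And>z. poly (cpoly f) z = 0 \<Longrightarrow> z \<noteq> of_real t \<Longrightarrow> norm z \<le> 1"
    and f0: "\<bar>poly f 0\<bar> = 1" and C0: "\<bar>poly C 0\<bar> = 1"
    by (rule minpoly_factorization[OF order.refl t]) blast
  have "cyclotomic_poly C"
    unfolding cyclotomic_poly_def
  proof (intro conjI allI impI)
    fix z :: complex assume z: "poly (cpoly C) z = 0"
    have "z \<noteq> 0"
      using z C0 poly_map_of_int_of_int[of C 0, where ?'a = complex] by auto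
    with z lC rC show "\<exists>k>0. z ^ k = 1" by (intro kronecker_root_of_unity)
  qed (rule lC)
  moreover have "map_poly of_int (T 0) = map_poly rat_of_int f * map_poly of_int C"
    unfolding fC by (rule map_poly_of_int_mult)
  moreover have "salem_number t \<or> reciprocal_pisot_number t"
  proof -
    have conj: "conjugates (of_real t) = {z. poly (cpoly f) z = 0}"
      using conjugates_eq[OF m] by (simp add: map_poly_of_rat_of_int)
    have ft: "poly (cpoly f) (of_real t) = 0"
      using m by (simp add: is_minpoly_def map_poly_of_rat_of_int)
    have ai: "algebraic_int t"
      unfolding algebraic_int_altdef_ipoly using ft lf
      by (intro exI[of _ f]) (simp add: poly_map_of_int_of_real)
    show ?thesis
    proof (cases "\<exists>z. poly (cpoly f) z = 0 \<and> z \<noteq> of_real t \<and> norm z = 1")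
      case True
      then show ?thesis using ai t(1) rf by (auto simp: salem_number_def conj)
    next
      case False
      then have small: "norm z < 1" if "poly (cpoly f) z = 0" "z \<noteq> of_real t" for z
        using that rf[of z] by force
      then have pisot: "pisot_number t" using ai t(1) by (auto simp: pisot_number_def conj)
      \<comment> \<open>The reflection of a conjugate inside the disc is a zero of
        \<open>T 0\<close> outside it, hence equals \<open>t\<close>.\<close>
      have inv: "z = 1 / of_real t" if z: "poly (cpoly f) z = 0" "z \<noteq> of_real t" for z
      proof -
        have Tz: "poly (cpoly (T 0)) z = 0" using z by (simp add: fC map_poly_of_int_mult)
        have "z \<noteq> 0" using Tz T_0 by auto
        then have "norm (1 / cnj z) > 1" using small[OF z] by (simp add: norm_divide)
        then have "1 / cnj z = of_real t"
          using outer_root_unique[OF order.refl _ root_reflect[OF Tz] _ t(2)] t(1) by auto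
        then have "cnj (1 / cnj z) = cnj (of_real t)" by simp
        then show ?thesis using \<open>z \<noteq> 0\<close> t(1) by (simp add: field_simps)
      qed
      have sq: "rsquarefree (cpoly f)"
        using is_minpoly_rsquarefree[OF m] by (simp add: map_poly_of_rat_of_int)
      have F: "(\<Prod>z | poly (cpoly f) z = 0. [:- z, 1:]) = cpoly f"
        using complex_poly_decompose_rsquarefree[OF sq] lf
        by (simp only: lead_coeff_map_of_int of_int_1 smult_1_left)
      have tne: "complex_of_real t \<noteq> 1 / of_real t"
      proof
        assume "complex_of_real t = 1 / of_real t"
        then have "of_real t * of_real t = (1 :: complex)" using t(1) by (simp add: field_simps)
        then have "t * t = 1" by (metis of_real_mult of_real_eq_1_iff)
        then show False using t(1) less_1_mult[of t t] by simp
      qed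
      \<comment> \<open>If \<open>t\<close> were the only zero, squarefreeness would make
        \<open>f\<close> linear with constant coefficient of modulus \<open>t > 1\<close>, not
        1.\<close>
      have "{z. poly (cpoly f) z = 0} = {of_real t, 1 / of_real t}"
      proof (rule ccontr)
        assume "\<not> ?thesis"
        then have "{z. poly (cpoly f) z = 0} = {of_real t}" using inv ft by auto
        then have "cpoly f = [:- of_real t, 1:]" using F by simp
        then have "norm (poly (cpoly f) (of_int 0)) = t" using t(1) by simp
        then have "real_of_int \<bar>poly f 0\<bar> = t" unfolding poly_map_of_int_of_int by simp
        then show False using f0 t(1) by simp
      qed
      then have "cpoly f = [:- of_real t, 1:] * [:- (1 / of_real t), 1:]"
        using F tne by simp
      also have "\<dots> = [:1, - of_real t - 1 / of_real t, 1:]" using t(1) by simp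
      finally have F2: "cpoly f = [:1, - of_real t - 1 / of_real t, 1:]" .
      have "degree f = degree (cpoly f)" by (simp add: degree_map_poly)
      then have deg: "degree f = 2" by (simp add: F2)
      have "of_int (coeff f 0) = (1 :: complex)"
        using arg_cong[OF F2, of "\<lambda>F. coeff F 0"] by (simp add: coeff_map_poly)
      then have "coeff f 0 = 1" by simp
      moreover have "coeff f 2 = 1" using lf deg by simp
      ultimately have "reflect_poly f = f"
        using deg by (intro poly_eqI)
          (auto simp: coeff_reflect_poly coeff_eq_0 less_Suc_eq numeral_2_eq_2 not_less le_Suc_eq)
      moreover have "reflect_poly (map_poly rat_of_int f) = map_poly of_int (reflect_poly f)"
        by (intro poly_eqI) (simp add: coeff_reflect_poly coeff_map_poly degree_map_poly)
      ultimately have "reflect_poly (map_poly rat_of_int f) = map_poly of_int f" by simp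
      with pisot m show ?thesis by (auto simp: reciprocal_pisot_number_def reciprocal_poly_def)
    qed
  qed
  ultimately show ?thesis
    by (intro exI[of _ t] exI[of _ "map_poly of_int f"] exI[of _ C] conjI m)
qed

lemma pisot_part: "\<exists>t::real. pisot_number t \<and> is_minpoly (map_poly of_int (T 1)) (of_real t)"
proof -
  have "poly (T 1) 1 = - poly p 1 - poly q 1" by (simp add: T_def)
  then have "poly (T 1) 1 < 0 \<or> poly (T 1) 1 = 0 \<and> poly (pderiv (T 1)) 1 < 0"
    using nonneg_at_1 by auto
  then obtain t where t: "t > 1" "poly (cpoly (T 1)) (of_real t) = 0"
    by (rule outer_root_exists)
  obtain f C where fC: "T 1 = f * C" and m: "is_minpoly (map_poly of_int f) (complex_of_real t)"
    and lf: "lead_coeff f = 1" and lC: "lead_coeff C = 1"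
    and rC: "\<And>z. poly (cpoly C) z = 0 \<Longrightarrow> norm z \<le> 1"
    and rf: "\<And>z. poly (cpoly f) z = 0 \<Longrightarrow> z \<noteq> of_real t \<Longrightarrow> norm z \<le> 1"
    and C0: "\<bar>poly C 0\<bar> = 1"
    by (rule minpoly_factorization[OF zero_le_one t]) blast
  have cT: "cpoly (T 1) = cpoly f * cpoly C" unfolding fC by (rule map_poly_of_int_mult)
  have ne: "norm z \<noteq> 1" if "poly (cpoly f) z = 0 \<or> poly (cpoly C) z = 0" for z
    using no_root_on_circle[of 1 z] that by (auto simp: cT)
  have lC': "lead_coeff (cpoly C) = 1" using lC by (simp only: lead_coeff_map_of_int of_int_1 zero_less_one)
  obtain root where root: "\<And>i. i < degree (cpoly C) \<Longrightarrow> poly (cpoly C) (root i) = 0"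
    "norm (poly (cpoly C) 0) = (\<Prod>i<degree (cpoly C). norm (root i))"
    by (rule norm_poly_0_eq_prod_roots[OF lC']) blast
  have "norm (poly (cpoly C) (of_int 0)) = 1"
    unfolding poly_map_of_int_of_int using C0 by simp
  then have prod1: "(\<Prod>i<degree (cpoly C). norm (root i)) = 1" using root(2) by simp
  \<comment> \<open>All zeros of \<open>C\<close> lie strictly inside the disc, yet their moduli
    multiply to 1; so there are none, and \<open>T 1\<close> itself is the minimal
    polynomial.\<close>
  have "degree (cpoly C) = 0"
  proof (rule ccontr)
    assume d: "degree (cpoly C) \<noteq> 0"
    have lt: "norm (root i) < 1" if "i < degree (cpoly C)" for i
      using rC[of "root i"] ne[of "root i"] root(1)[OF that] by force
    have "(\<Prod>i<degree (cpoly C). norm (root i))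
        = norm (root 0) * (\<Prod>i\<in>{..<degree (cpoly C)} - {0}. norm (root i))"
      using d by (intro prod.remove) auto
    also have "\<dots> \<le> norm (root 0) * 1"
      using lt by (intro mult_left_mono prod_le_1) (auto intro: less_imp_le)
    also have "\<dots> < 1" using lt[of 0] d by simp
    finally have "(\<Prod>i<degree (cpoly C). norm (root i)) < 1" .
    then show False using prod1 by simp
  qed
  then have "degree C = 0" by (simp add: degree_map_poly)
  then have "C = 1" using lC by (auto elim!: degree_eq_zeroE)
  then have Tf: "T 1 = f" using fC by simp
  have ft: "poly (cpoly f) (of_real t) = 0" using t(2) Tf by simp
  have "algebraic_int t"
    unfolding algebraic_int_altdef_ipoly using ft lf
    by (intro exI[of _ f]) (simp add: poly_map_of_int_of_real)
  moreover have "conjugates (of_real t) = {z. poly (cpoly f) z = 0}"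
    using conjugates_eq[OF m] by (simp add: map_poly_of_rat_of_int)
  moreover have "norm z < 1" if "poly (cpoly f) z = 0" "z \<noteq> of_real t" for z
    using rf[OF that] ne[of z] that by auto
  ultimately have "pisot_number t" using t(1) by (auto simp: pisot_number_def)
  with m Tf show ?thesis by auto
qed

end

theorem proposition5:
  fixes p q :: "int poly"
  assumes interlacing: "circular_interlacing (map_poly of_int p) (map_poly of_int q)"
    and monic: "lead_coeff p = 1"
  shows "cyclotomic_poly p \<and> (poly p 1 = 0 \<or> poly q 1 = 0) \<and>
    (poly p 1 = 0 \<or> (poly q 1 = 0 \<and> 2 * poly p 1 - poly (pderiv q) 1 < 0) \<longrightarrow>
      (\<exists>(t::real) (m::rat poly) (C::int poly).
        (salem_number t \<or> reciprocal_pisot_number t) \<and>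
        is_minpoly m (of_real t) \<and> cyclotomic_poly C \<and>
        map_poly of_int ([:-1, 0, 1:] * p - [:0, 1:] * q) = m * map_poly of_int C)) \<and>
    (\<exists>t::real. pisot_number t \<and>
        is_minpoly (map_poly of_int ([:-1, -1, 1:] * p - [:0, 1:] * q)) (of_real t))"
proof -
  interpret interlacing_int_pair p q by unfold_locales (fact assms)+
  have T: "T 0 = [:-1, 0, 1:] * p - [:0, 1:] * q" "T 1 = [:-1, -1, 1:] * p - [:0, 1:] * q"
    by (simp_all only: T_def minus_zero)
  show ?thesis
  proof (intro conjI)
    show "cyclotomic_poly p" by (rule cyclotomic_p)
    show "poly p 1 = 0 \<or> poly q 1 = 0" by (rule root_at_1)
  qed (rule impI, erule salem_part[unfolded T], rule pisot_part[unfolded T])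
qed

end
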